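(* Let $G$ be a finitely generated group and let $k\ge2$ be an integer. Let $\mathbb{F}_k$ denote the non-abelian free group of rank $k$. The following are equivalent: (i) $G$ is non-amenable; (ii) $G$ admits a translation-like action by $\mathbb{F}_k$; (iii) $G$ admits a transitive translation-like action by $\mathbb{F}_k$.
   Context: $G$ is given a word metric $d_S(g,h)=\min\{n: g^{-1}h\in(S\cup S^{-1})^n\}$ for a finite generating set $S$ (the choice of $S$ does not matter). A right action $*$ of a group $H$ on a metric space $(X,d)$ is translation-like if it is free ($x*h=x$ implies $h=1_H$) and for every $h\in H$ the set $\{d(x,x*h):x\in X\}$ is bounded. *)

theory Defs
  imports "HOL-Algebra.Algebra"
begin

definition prod_set :: "('a, 'b) monoid_scheme \<Rightarrow> 'a set \<Rightarrow> nat \<Rightarrow> 'a set" where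
  "prod_set G T n = {foldr (\<otimes>\<^bsub>G\<^esub>) l \<one>\<^bsub>G\<^esub> | l. length l = n \<and> set l \<subseteq> T}"

definition word_dist :: "('a, 'b) monoid_scheme \<Rightarrow> 'a set \<Rightarrow> 'a \<Rightarrow> 'a \<Rightarrow> nat" where
  "word_dist G S g h =
     (LEAST n. m_inv G g \<otimes>\<^bsub>G\<^esub> h \<in> prod_set G (S \<union> m_inv G ` S) n)"

definition right_action ::
  "('a, 'b) monoid_scheme \<Rightarrow> ('c, 'd) monoid_scheme \<Rightarrow> ('a \<Rightarrow> 'c \<Rightarrow> 'a) \<Rightarrow> bool" where
  "right_action M H act \<longleftrightarrow>
     (\<forall>x\<in>carrier M. \<forall>h\<in>carrier H. act x h \<in> carrier M) \<and>
     (\<forall>x\<in>carrier M. act x (one H) = x) \<and>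
     (\<forall>x\<in>carrier M. \<forall>h\<in>carrier H. \<forall>h'\<in>carrier H.
         act x (monoid.mult H h h') = act (act x h) h')"

definition translation_like ::
  "('a, 'b) monoid_scheme \<Rightarrow> 'a set \<Rightarrow> ('c, 'd) monoid_scheme \<Rightarrow> ('a \<Rightarrow> 'c \<Rightarrow> 'a) \<Rightarrow> bool" where
  "translation_like G S H act \<longleftrightarrow>
     right_action G H act \<and>
     (\<forall>x\<in>carrier G. \<forall>h\<in>carrier H. act x h = x \<longrightarrow> h = one H) \<and>
     (\<forall>h\<in>carrier H. \<exists>B. \<forall>x\<in>carrier G. word_dist G S x (act x h) \<le> B)"

definition transitive_action ::
  "('a, 'b) monoid_scheme \<Rightarrow> ('c, 'd) monoid_scheme \<Rightarrow> ('a \<Rightarrow> 'c \<Rightarrow> 'a) \<Rightarrow> bool" where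
  "transitive_action G H act \<longleftrightarrow>
     (\<forall>x\<in>carrier G. \<forall>y\<in>carrier G. \<exists>h\<in>carrier H. act x h = y)"

definition amenable :: "('a, 'b) monoid_scheme \<Rightarrow> bool" where
  "amenable G \<longleftrightarrow> (\<exists>\<mu> :: 'a set \<Rightarrow> real.
     (\<forall>A. A \<subseteq> carrier G \<longrightarrow> \<mu> A \<ge> 0) \<and>
     \<mu> (carrier G) = 1 \<and>
     (\<forall>A B. A \<subseteq> carrier G \<longrightarrow> B \<subseteq> carrier G \<longrightarrow> A \<inter> B = {} \<longrightarrow>
         \<mu> (A \<union> B) = \<mu> A + \<mu> B) \<and>
     (\<forall>g\<in>carrier G. \<forall>A. A \<subseteq> carrier G \<longrightarrow> \<mu> ((\<lambda>a. g \<otimes>\<^bsub>G\<^esub> a) ` A) = \<mu> A))"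

text \<open>Letters are (i, b) with i < k a generator index; b = True means the
  generator x_i, b = False its inverse.\<close>
fun push :: "nat \<times> bool \<Rightarrow> (nat \<times> bool) list \<Rightarrow> (nat \<times> bool) list" where
  "push a [] = [a]"
| "push a (b # bs) = (if fst a = fst b \<and> snd a \<noteq> snd b then bs else a # b # bs)"

fun reduced :: "(nat \<times> bool) list \<Rightarrow> bool" where
  "reduced [] = True"
| "reduced [a] = True"
| "reduced (a # b # bs) = (\<not> (fst a = fst b \<and> snd a \<noteq> snd b) \<and> reduced (b # bs))"

definition free_group :: "nat \<Rightarrow> (nat \<times> bool) list monoid" where
  "free_group k = \<lparr> carrier = {w. reduced w \<and> (\<forall>a\<in>set w. fst a < k)},
                    monoid.mult = (\<lambda>v w. foldr push v w),
                    monoid.one = [] \<rparr>"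

end

theory Submission
  imports Defs "HOL-Analysis.Function_Topology" "HOL-Library.Sublist"
begin

text \<open>A free action by bounded moves transports a right-invariant mean of \<open>G\<close> to a mean invariant under
  the free group, and the usual paradoxical decomposition by last letters rules this out. Conversely,
  if \<open>G\<close> is not amenable, the failure of Folner's condition and Hall's theorem give a map
  \<open>f : G \<rightarrow> G\<close> of bounded displacement all of whose fibres have at least \<open>2 * k + 2\<close> elements. In each
  component of \<open>f\<close> choose a point \<open>b\<close> closest to the identity, reverse \<open>f\<close> along the forward orbit of
  \<open>b\<close>, and attach \<open>b\<close> to a neighbour closer to the identity. This turns \<open>G\<close> into a single rooted tree
  with short edges in which every vertex keeps at least \<open>2 * k\<close> children. A left-child right-sibling
  encoding rearranges it into the \<open>2 * k\<close>-regular tree, that is, into a bijection from the free group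
  to \<open>G\<close> that moves Cayley neighbours to points at bounded distance. Right multiplication transported
  along this bijection is the required action.\<close>

section \<open>Free groups\<close>

text \<open>The word metric is left-invariant, so a map \<open>f\<close> has bounded displacement
  exactly when the elements \<open>inv x \<otimes> f x\<close> form a finite set. Hence means are
  taken right-invariant, although \<open>amenable\<close> speaks of left translations. In the
  converse the obstacle is transitivity. A map with large fibres may have infinitely many
  components, and a component contains a cycle or an endless forward ray, so it has no root. The
  components are ranked by the length of their closest point to the identity: the shortening step
  from that point lands in a component of strictly smaller rank, so the linking terminates. The
  constant \<open>2 * k + 2\<close> splits as follows. Reversing a forward orbit costs a vertex at
  most two preimages, one along the tail of the orbit and one where it closes into a cycle. The
  remaining \<open>2 * k\<close> are the branching at the empty word, whose sibling list is a
  singleton, so that all its slots must be filled by children. The number of children varies from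
  vertex to vertex; the encoding absorbs any surplus, since it uses only a lower bound.\<close>

definition letter_inv :: "nat \<times> bool \<Rightarrow> nat \<times> bool" where
  "letter_inv a = (fst a, \<not> snd a)"

lemma letter_inv_letter_inv [simp]: "letter_inv (letter_inv a) = a"
  by (simp add: letter_inv_def)

lemma fst_letter_inv [simp]: "fst (letter_inv a) = fst a"
  by (simp add: letter_inv_def)

text \<open>Puts the cancellation test of \<open>push\<close> and \<open>reduced\<close> into terms
  of \<open>letter_inv\<close>; the original equations are removed from the simp set wherever this
  form has to survive.\<close>

lemma cancel_iff: "fst a = fst b \<and> snd a \<noteq> snd b \<longleftrightarrow> b = letter_inv a"
  by (auto simp: letter_inv_def prod_eq_iff)

lemma push_Cons: "push a (b # bs) = (if b = letter_inv a then bs else a # b # bs)"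
  using cancel_iff[of a b] by (simp only: push.simps)

lemma reduced_Cons: "reduced (a # w) \<longleftrightarrow> reduced w \<and> (w = [] \<or> hd w \<noteq> letter_inv a)"
proof (cases w)
  case (Cons b bs)
  then show ?thesis using cancel_iff[of a b] by (simp only: reduced.simps) auto
qed simp

lemma reduced_push: "reduced w \<Longrightarrow> reduced (push a w)"
  by (cases w) (auto simp: push_Cons reduced_Cons simp del: push.simps(2) reduced.simps(3))

lemma set_push: "set (push a w) \<subseteq> insert a (set w)"
  by (cases w) auto

lemma push_reduced: "reduced (a # w) \<Longrightarrow> push a w = a # w"
  by (cases w) (auto simp: push_Cons reduced_Cons simp del: push.simps(2) reduced.simps(3))

text \<open>Reducedness matters: for \<open>w = a # letter_inv a # u\<close> the first push removes
  \<open>a\<close>, the second removes \<open>letter_inv a\<close>, and \<open>u\<close> is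
  left.\<close>

lemma push_letter_inv: "reduced w \<Longrightarrow> push a (push (letter_inv a) w) = w"
  by (cases w) (auto simp: push_Cons reduced_Cons push_reduced simp del: push.simps(2) reduced.simps(3))

lemma reduced_foldr_push: "reduced w \<Longrightarrow> reduced (foldr push v w)"
  by (induction v) (auto intro: reduced_push)

lemma set_foldr_push: "set (foldr push v w) \<subseteq> set v \<union> set w"
  by (induction v) (use set_push in fastforce)+

text \<open>The inductive step of associativity. If \<open>push a v\<close> cancels a letter, the
  same letter cancels again on the other side by \<open>push_letter_inv\<close>.\<close>

lemma foldr_push_push: "reduced w \<Longrightarrow> foldr push (push a v) w = push a (foldr push v w)"
proof (cases v)
  case (Cons b bs)
  assume "reduced w"
  then show ?thesis
    using push_letter_inv[of "foldr push bs w" a] reduced_foldr_push[of w bs]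
    by (simp add: Cons push_Cons del: push.simps(2))
qed simp

lemma foldr_push_assoc:
  "reduced w \<Longrightarrow> foldr push (foldr push u v) w = foldr push u (foldr push v w)"
  by (induction u) (simp_all add: foldr_push_push)

lemma foldr_push_rev_letter_inv: "foldr push (rev (map letter_inv w)) w = []"
  by (induction w) (simp_all add: push_Cons del: push.simps(2))

text \<open>\<open>push\<close> works at the left end of a word, while the Cayley tree grows at the
  right end: right multiplication by a letter moves to a child or back to the parent prefix. Both
  directions of the theorem rest on this.\<close>

lemma foldr_push_snoc:
  assumes "reduced w"
  shows "foldr push w [a] = (if w \<noteq> [] \<and> last w = letter_inv a then butlast w else w @ [a])"
  using assms
proof (induction w)
  case (Cons b w)
  show ?case
  proof (cases "w = []")
    case True
    then show ?thesis by (auto simp: push_Cons simp del: push.simps(2))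
  next
    case False
    have r: "reduced w" and h: "hd w \<noteq> letter_inv b"
      using Cons.prems False by (auto simp: reduced_Cons simp del: reduced.simps(3))
    show ?thesis
    proof (cases "last w = letter_inv a")
      case True
      have "push b (butlast w) = b # butlast w"
      proof (cases "butlast w")
        case (Cons c cs)
        then have "c = hd w" using False by (cases w) (auto split: if_splits)
        then show ?thesis using h Cons by (simp add: push_Cons del: push.simps(2))
      qed simp
      then show ?thesis using Cons.IH[OF r] False True by simp
    next
      case nl: False
      have "push b (w @ [a]) = b # w @ [a]"
        using h False by (cases w) (auto simp: push_Cons simp del: push.simps(2))
      then show ?thesis using Cons.IH[OF r] False nl by simp
    qed
  qed
qed simp

lemma carrier_free_group: "w \<in> carrier (free_group k) \<longleftrightarrow> reduced w \<and> (\<forall>a\<in>set w. fst a < k)"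
  and mult_free_group: "v \<otimes>\<^bsub>free_group k\<^esub> w = foldr push v w"
  and one_free_group: "\<one>\<^bsub>free_group k\<^esub> = []"
  by (auto simp: free_group_def)

lemma free_group_mult_closed:
  "\<lbrakk>v \<in> carrier (free_group k); w \<in> carrier (free_group k)\<rbrakk> \<Longrightarrow> foldr push v w \<in> carrier (free_group k)"
  using set_foldr_push[of v w] by (auto simp: carrier_free_group intro: reduced_foldr_push)

lemma group_free_group: "group (free_group k)"
proof (rule groupI)
  fix w assume w: "w \<in> carrier (free_group k)"
  \<comment> \<open>Multiplying the reversed inverse word into \<open>[]\<close> makes membership in
    the carrier immediate, without a proof that reversal preserves \<open>reduced\<close>.\<close>
  let ?u = "foldr push (rev (map letter_inv w)) []"
  have "foldr push ?u w = []"
    using w foldr_push_assoc[of w "rev (map letter_inv w)" "[]"]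
    by (simp add: carrier_free_group foldr_push_rev_letter_inv)
  moreover have "?u \<in> carrier (free_group k)"
    using w set_foldr_push[of "rev (map letter_inv w)" "[]"]
    by (fastforce simp: carrier_free_group intro: reduced_foldr_push)
  ultimately show "\<exists>u\<in>carrier (free_group k). u \<otimes>\<^bsub>free_group k\<^esub> w = \<one>\<^bsub>free_group k\<^esub>"
    by (auto simp: mult_free_group one_free_group)
qed (auto simp: mult_free_group one_free_group free_group_mult_closed foldr_push_assoc
    carrier_free_group[of "[]"] carrier_free_group[THEN iffD1])

lemma letter_in_free_group: "fst a < k \<Longrightarrow> [a] \<in> carrier (free_group k)"
  by (simp add: carrier_free_group)

lemma free_group_Cons:
  assumes "a # w \<in> carrier (free_group k)"
  shows "fst a < k" "w \<in> carrier (free_group k)" "[a] \<otimes>\<^bsub>free_group k\<^esub> w = a # w"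
  using assms by (auto simp: carrier_free_group mult_free_group push_reduced reduced_Cons
      simp del: reduced.simps(3))

lemma reduced_snoc: "reduced (w @ [a]) \<longleftrightarrow> reduced w \<and> (w = [] \<or> last w \<noteq> letter_inv a)"
  by (induction w) (auto simp: reduced_Cons hd_append simp del: reduced.simps(3))

section \<open>Invariant means\<close>

text \<open>Tychonoff's theorem; it supplies the limit of the counting measures on Folner
  sets.\<close>

lemma compact_unit_cube: "compact (UNIV \<rightarrow>\<^sub>E {0..1::real} :: ('i \<Rightarrow> real) set)"
proof -
  have "compactin (product_topology (\<lambda>_. euclidean) UNIV) (UNIV \<rightarrow>\<^sub>E {0..1::real} :: ('i \<Rightarrow> real) set)"
    by (simp add: compactin_PiE)
  then show ?thesis by (simp add: euclidean_product_topology)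
qed

definition right_invariant_mean :: "('a, 'b) monoid_scheme \<Rightarrow> ('a set \<Rightarrow> real) \<Rightarrow> bool" where
  "right_invariant_mean G \<nu> \<longleftrightarrow>
     (\<forall>A. A \<subseteq> carrier G \<longrightarrow> \<nu> A \<ge> 0) \<and> \<nu> (carrier G) = 1 \<and>
     (\<forall>A B. A \<subseteq> carrier G \<longrightarrow> B \<subseteq> carrier G \<longrightarrow> A \<inter> B = {} \<longrightarrow> \<nu> (A \<union> B) = \<nu> A + \<nu> B) \<and>
     (\<forall>g\<in>carrier G. \<forall>A. A \<subseteq> carrier G \<longrightarrow> \<nu> ((\<lambda>a. a \<otimes>\<^bsub>G\<^esub> g) ` A) = \<nu> A)"

lemma (in group) inv_image_mult:
  assumes "g \<in> carrier G" "A \<subseteq> carrier G"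
  shows "m_inv G ` (\<lambda>a. g \<otimes> a) ` A = (\<lambda>a. a \<otimes> inv g) ` m_inv G ` A"
    and "m_inv G ` (\<lambda>a. a \<otimes> g) ` A = (\<lambda>a. inv g \<otimes> a) ` m_inv G ` A"
  using assms by (auto simp: image_image inv_mult_group subset_iff intro!: image_cong)

lemma (in group) inv_image_carrier: "m_inv G ` carrier G = carrier G"
  by (auto simp: image_iff) (metis inv_closed inv_inv)

lemma (in group) inv_image_disjoint:
  "\<lbrakk>A \<subseteq> carrier G; B \<subseteq> carrier G; A \<inter> B = {}\<rbrakk> \<Longrightarrow> m_inv G ` A \<inter> m_inv G ` B = {}"
  by (auto simp: subset_iff)

lemma right_invariant_meanD:
  assumes "right_invariant_mean G \<nu>"
  shows "A \<subseteq> carrier G \<Longrightarrow> \<nu> A \<ge> 0" "\<nu> (carrier G) = 1"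
    "\<lbrakk>A \<subseteq> carrier G; B \<subseteq> carrier G; A \<inter> B = {}\<rbrakk> \<Longrightarrow> \<nu> (A \<union> B) = \<nu> A + \<nu> B"
    "\<lbrakk>g \<in> carrier G; A \<subseteq> carrier G\<rbrakk> \<Longrightarrow> \<nu> ((\<lambda>a. a \<otimes>\<^bsub>G\<^esub> g) ` A) = \<nu> A"
  using assms unfolding right_invariant_mean_def by simp_all

text \<open>Precomposing a mean with inversion exchanges left and right translates.\<close>

lemma (in group) amenable_iff_right_invariant_mean:
  "amenable G \<longleftrightarrow> (\<exists>\<nu>. right_invariant_mean G \<nu>)"
proof
  have sub: "m_inv G ` A \<subseteq> carrier G" if "A \<subseteq> carrier G" for A using that by auto
  assume "amenable G"
  then obtain \<mu> :: "'a set \<Rightarrow> real" where *: "(\<forall>A. A \<subseteq> carrier G \<longrightarrow> \<mu> A \<ge> 0) \<and> \<mu> (carrier G) = 1 \<and>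
    (\<forall>A B. A \<subseteq> carrier G \<longrightarrow> B \<subseteq> carrier G \<longrightarrow> A \<inter> B = {} \<longrightarrow> \<mu> (A \<union> B) = \<mu> A + \<mu> B) \<and>
    (\<forall>g\<in>carrier G. \<forall>A. A \<subseteq> carrier G \<longrightarrow> \<mu> ((\<lambda>a. g \<otimes> a) ` A) = \<mu> A)"
    unfolding amenable_def ..
  have \<mu>: "\<And>A. A \<subseteq> carrier G \<Longrightarrow> \<mu> A \<ge> 0" "\<mu> (carrier G) = 1"
    "\<And>A B. \<lbrakk>A \<subseteq> carrier G; B \<subseteq> carrier G; A \<inter> B = {}\<rbrakk> \<Longrightarrow> \<mu> (A \<union> B) = \<mu> A + \<mu> B"
    "\<And>g A. \<lbrakk>g \<in> carrier G; A \<subseteq> carrier G\<rbrakk> \<Longrightarrow> \<mu> ((\<lambda>a. g \<otimes> a) ` A) = \<mu> A"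
    using * by simp_all
  have "right_invariant_mean G (\<lambda>A. \<mu> (m_inv G ` A))"
    unfolding right_invariant_mean_def
  proof (intro conjI allI impI ballI)
    fix A B assume "A \<subseteq> carrier G" "B \<subseteq> carrier G" "A \<inter> B = {}"
    then show "\<mu> (m_inv G ` (A \<union> B)) = \<mu> (m_inv G ` A) + \<mu> (m_inv G ` B)"
      unfolding image_Un by (intro \<mu>(3) sub inv_image_disjoint)
  next
    fix g A assume "g \<in> carrier G" "A \<subseteq> carrier G"
    then show "\<mu> (m_inv G ` (\<lambda>a. a \<otimes> g) ` A) = \<mu> (m_inv G ` A)"
      by (simp add: inv_image_mult \<mu>(4) sub)
  qed (simp_all add: \<mu> sub inv_image_carrier)
  then show "\<exists>\<nu>. right_invariant_mean G \<nu>" by blast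
next
  have sub: "m_inv G ` A \<subseteq> carrier G" if "A \<subseteq> carrier G" for A using that by auto
  assume "\<exists>\<nu>. right_invariant_mean G \<nu>"
  then obtain \<nu> where "right_invariant_mean G \<nu>" ..
  note \<nu> = right_invariant_meanD[OF this]
  show "amenable G"
    unfolding amenable_def
  proof (intro exI[of _ "\<lambda>A. \<nu> (m_inv G ` A)"] conjI allI impI ballI)
    fix A B assume "A \<subseteq> carrier G" "B \<subseteq> carrier G" "A \<inter> B = {}"
    then show "\<nu> (m_inv G ` (A \<union> B)) = \<nu> (m_inv G ` A) + \<nu> (m_inv G ` B)"
      unfolding image_Un by (intro \<nu>(3) sub inv_image_disjoint)
  next
    fix g A assume "g \<in> carrier G" "A \<subseteq> carrier G"
    then show "\<nu> (m_inv G ` (\<lambda>a. g \<otimes> a) ` A) = \<nu> (m_inv G ` A)"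
      by (simp add: inv_image_mult \<nu>(4) sub)
  qed (simp_all add: \<nu> sub inv_image_carrier)
qed

text \<open>Means are sought as points of a compact cube. Normalisation, additivity and approximate
  invariance under one \<open>g\<close> are closed conditions, and the normalised counting measure
  of a Folner set satisfies any finitely many of them.\<close>

lemma (in group) folner_imp_right_invariant_mean:
  assumes folner: "\<And>T (e::real). \<lbrakk>finite T; T \<subseteq> carrier G; 0 < e\<rbrakk> \<Longrightarrow>
    \<exists>A. finite A \<and> A \<noteq> {} \<and> A \<subseteq> carrier G \<and> card (A <#> T) \<le> (1 + e) * card A"
  shows "\<exists>\<nu>. right_invariant_mean G \<nu>"
proof -
  define K :: "('a set \<Rightarrow> real) set" where "K = (UNIV \<rightarrow>\<^sub>E {0..1})"
  \<comment> \<open>A one-sided estimate is enough: once \<open>e\<close> tends to 0, applying it to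
    \<open>inv g\<close> gives the reverse inequality.\<close>
  define C where "C g e = {\<nu> :: 'a set \<Rightarrow> real. \<nu> (carrier G) = 1 \<and>
    (\<forall>A B. A \<subseteq> carrier G \<and> B \<subseteq> carrier G \<and> A \<inter> B = {} \<longrightarrow> \<nu> (A \<union> B) = \<nu> A + \<nu> B) \<and>
    (\<forall>B. B \<subseteq> carrier G \<longrightarrow> \<nu> ((\<lambda>a. a \<otimes> g) ` B) \<le> \<nu> B + e)}" for g e
  have closedC: "closed (C g e)" for g e
    unfolding C_def
    by (intro closed_Collect_conj closed_Collect_all closed_Collect_imp closed_Collect_eq
        closed_Collect_le open_Collect_const continuous_on_add continuous_on_const
        continuous_on_product_coordinates)
  have fip: "K \<inter> (\<Inter>(g, e)\<in>I. C g e) \<noteq> {}"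
    if I: "finite I" "I \<subseteq> carrier G \<times> {0<..}" for I
  proof -
    \<comment> \<open>Inverses occur because \<open>A \<inter> B g\<close> is pulled back by
      \<open>inv g\<close>. The element \<open>\<one>\<close> gives
      \<open>A \<subseteq> A <#> T\<close>, so the boundary is counted by a subtraction. In
      \<open>e\<close>, the value 1 keeps \<open>Min\<close> meaningful for empty
      \<open>I\<close>.\<close>
    define T where "T = insert \<one> (m_inv G ` fst ` I)"
    define e where "e = Min (insert 1 (snd ` I))"
    have T: "finite T" "T \<subseteq> carrier G" using I by (auto simp: T_def)
    have e: "e > 0" using I by (auto simp: e_def)
    obtain A where A: "finite A" "A \<noteq> {}" "A \<subseteq> carrier G" "card (A <#> T) \<le> (1 + e) * card A"
      using folner[OF T e] by blast
    define \<nu> where "\<nu> B = card (A \<inter> B) / card A" for B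
    have cA: "card A > 0" using A by (simp add: card_gt_0_iff)
    have finAT: "finite (A <#> T)" using A(1) T(1) by (simp add: set_mult_def)
    have "A \<subseteq> A <#> T" using A(3) by (force simp: set_mult_def T_def)
    then have "card ((A <#> T) - A) = card (A <#> T) - card A" "card A \<le> card (A <#> T)"
      using A(1) finAT by (auto simp: card_Diff_subset card_mono)
    then have small: "real (card ((A <#> T) - A)) \<le> e * card A"
      using A(4) by (simp add: algebra_simps)
    have "\<nu> B \<in> {0..1}" for B
      using cA A(1) by (auto simp: \<nu>_def divide_le_eq card_mono)
    then have "\<nu> \<in> K" by (auto simp: K_def PiE_def extensional_def)
    moreover have "\<nu> \<in> C g e'" if "(g, e') \<in> I" for g e'
    proof -
      have g: "g \<in> carrier G" "inv g \<in> T" using that I by (auto simp: T_def rev_image_eqI)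
      have "e \<le> e'" using that I unfolding e_def by (intro Min_le) (auto simp: rev_image_eqI)
      have norm: "\<nu> (carrier G) = 1" using A(3) cA by (simp add: \<nu>_def Int_absorb2)
      have add: "\<nu> (B \<union> D) = \<nu> B + \<nu> D" if "B \<inter> D = {}" for B D
      proof -
        have "card (A \<inter> (B \<union> D)) = card (A \<inter> B) + card (A \<inter> D)"
          using that A(1) by (subst card_Un_disjoint[symmetric]) (auto simp: Int_Un_distrib)
        then show ?thesis by (simp add: \<nu>_def add_divide_distrib)
      qed
      have inv: "\<nu> ((\<lambda>a. a \<otimes> g) ` B) \<le> \<nu> B + e'" if B: "B \<subseteq> carrier G" for B
      proof -
        let ?Bg = "(\<lambda>a. a \<otimes> g) ` B"
        have "card (A \<inter> ?Bg) = card ((\<lambda>a. a \<otimes> inv g) ` (A \<inter> ?Bg))"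
          using A(3) g by (intro card_image[symmetric] inj_onI) (auto simp: subset_iff)
        also have "\<dots> \<le> card ((A \<inter> B) \<union> ((A <#> T) - A))"
        proof (rule card_mono)
          have "a \<otimes> inv g \<in> B" if "a \<in> ?Bg" for a
            using that B g by (auto simp: m_assoc subset_iff)
          then show "(\<lambda>a. a \<otimes> inv g) ` (A \<inter> ?Bg) \<subseteq> (A \<inter> B) \<union> ((A <#> T) - A)"
            using g(2) by (auto simp: set_mult_def)
        qed (use A(1) finAT in auto)
        also have "\<dots> \<le> card (A \<inter> B) + card ((A <#> T) - A)" by (rule card_Un_le)
        finally have "real (card (A \<inter> ?Bg)) \<le> card (A \<inter> B) + e * card A" using small by linarith
        also have "\<dots> \<le> card (A \<inter> B) + e' * card A"
          using \<open>e \<le> e'\<close> by (simp add: mult_right_mono)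
        finally show ?thesis using cA by (simp add: \<nu>_def field_simps)
      qed
      show ?thesis using norm add inv by (auto simp: C_def)
    qed
    ultimately show ?thesis by auto
  qed
  have "K \<inter> (\<Inter>(g, e)\<in>carrier G \<times> {0<..}. C g e) \<noteq> {}"
  proof (rule compact_imp_fip_image)
    show "compact K" unfolding K_def by (rule compact_unit_cube)
    show "closed (case z of (g, e) \<Rightarrow> C g e)" for z by (cases z) (simp add: closedC)
  qed (rule fip)
  then obtain \<nu> where \<nu>: "\<nu> \<in> K" "\<And>g e. g \<in> carrier G \<Longrightarrow> 0 < e \<Longrightarrow> \<nu> \<in> C g e" by auto
  have le: "\<nu> ((\<lambda>a. a \<otimes> g) ` B) \<le> \<nu> B" if "g \<in> carrier G" "B \<subseteq> carrier G" for g B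
    by (rule field_le_epsilon) (use \<nu>(2)[OF that(1)] that(2) in \<open>auto simp: C_def\<close>)
  have "\<nu> ((\<lambda>a. a \<otimes> g) ` B) = \<nu> B" if g: "g \<in> carrier G" and B: "B \<subseteq> carrier G" for g B
  proof (rule antisym[OF le[OF g B]])
    have "(\<lambda>a. a \<otimes> inv g) ` (\<lambda>a. a \<otimes> g) ` B = B"
      using g B by (force simp: image_image m_assoc subset_iff)
    moreover have "(\<lambda>a. a \<otimes> g) ` B \<subseteq> carrier G" using g B by auto
    ultimately show "\<nu> B \<le> \<nu> ((\<lambda>a. a \<otimes> g) ` B)" using le[of "inv g" "(\<lambda>a. a \<otimes> g) ` B"] g by simp
  qed
  moreover have "\<nu> A \<ge> 0" for A using \<nu>(1) by (auto simp: K_def PiE_def)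
  moreover have "\<nu> \<in> C \<one> 1" using \<nu>(2) by simp
  ultimately have "right_invariant_mean G \<nu>" by (simp add: right_invariant_mean_def C_def)
  then show ?thesis by (intro exI[of _ \<nu>])
qed

section \<open>Expansion of finite sets in non-amenable groups\<close>

lemma (in group) nonamenable_expansion:
  assumes "\<not> amenable G"
  obtains T e where "finite T" "T \<subseteq> carrier G" "(0::real) < e"
    "\<And>A. \<lbrakk>finite A; A \<subseteq> carrier G\<rbrakk> \<Longrightarrow> (1 + e) * card A \<le> card (A <#> T)"
proof -
  have "\<exists>T e. finite T \<and> T \<subseteq> carrier G \<and> (0::real) < e \<and>
    (\<forall>A. finite A \<longrightarrow> A \<subseteq> carrier G \<longrightarrow> (1 + e) * card A \<le> card (A <#> T))"
  proof (rule ccontr)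
    assume no: "\<not> ?thesis"
    have "\<exists>A. finite A \<and> A \<noteq> {} \<and> A \<subseteq> carrier G \<and> card (A <#> T) \<le> (1 + e) * card A"
      if T: "finite T" "T \<subseteq> carrier G" "0 < e" for T and e :: real
    proof -
      obtain A where A: "finite A" "A \<subseteq> carrier G" "card (A <#> T) < (1 + e) * card A"
        using no T by (meson not_le)
      moreover have "A \<noteq> {}" using A(3) by auto
      ultimately show ?thesis by (intro exI[of _ A]) auto
    qed
    then have "amenable G"
      unfolding amenable_iff_right_invariant_mean by (rule folner_imp_right_invariant_mean)
    then show False using assms by blast
  qed
  then show thesis using that by blast
qed

text \<open>Each further factor \<open>T\<close> multiplies the expansion constant by
  \<open>1 + e\<close>, and some power of it exceeds \<open>n\<close>.\<close>

lemma (in group) nonamenable_large_expansion: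
  assumes "\<not> amenable G"
  obtains T where "finite T" "T \<subseteq> carrier G"
    "\<And>A. \<lbrakk>finite A; A \<subseteq> carrier G\<rbrakk> \<Longrightarrow> n * card A \<le> card (A <#> T)"
proof -
  obtain T e where T: "finite T" "T \<subseteq> carrier G" and e: "(0::real) < e"
    and exp: "\<And>A. \<lbrakk>finite A; A \<subseteq> carrier G\<rbrakk> \<Longrightarrow> (1 + e) * card A \<le> card (A <#> T)"
    using nonamenable_expansion[OF assms] by blast
  have pow: "\<exists>Q. finite Q \<and> Q \<subseteq> carrier G \<and>
    (\<forall>A. finite A \<longrightarrow> A \<subseteq> carrier G \<longrightarrow> (1 + e) ^ j * card A \<le> card (A <#> Q))" for j
  proof (induction j)
    case 0
    have "A <#> {\<one>} = A" if "A \<subseteq> carrier G" for A using that by (force simp: set_mult_def)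
    then show ?case by (intro exI[of _ "{\<one>}"]) auto
  next
    case (Suc j)
    then obtain Q where Q: "finite Q" "Q \<subseteq> carrier G"
      "\<And>A. finite A \<Longrightarrow> A \<subseteq> carrier G \<Longrightarrow> (1 + e) ^ j * card A \<le> card (A <#> Q)" by blast
    have "(1 + e) ^ Suc j * card A \<le> card (A <#> (Q <#> T))" if A: "finite A" "A \<subseteq> carrier G" for A
    proof -
      have AQ: "finite (A <#> Q)" "A <#> Q \<subseteq> carrier G"
        using A Q(1,2) by (auto simp: set_mult_def)
      have "(1 + e) ^ Suc j * card A = (1 + e) * ((1 + e) ^ j * card A)" by simp
      also have "\<dots> \<le> (1 + e) * card (A <#> Q)" using Q(3)[OF A] e by (intro mult_left_mono) auto
      also have "\<dots> \<le> card ((A <#> Q) <#> T)" using exp[OF AQ] .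
      also have "(A <#> Q) <#> T = A <#> (Q <#> T)" using A(2) Q(2) T(2) by (rule set_mult_assoc)
      finally show ?thesis .
    qed
    moreover have "finite (Q <#> T)" "Q <#> T \<subseteq> carrier G"
      using T Q(1,2) by (auto simp: set_mult_def)
    ultimately show ?case by blast
  qed
  obtain j where j: "real n < (1 + e) ^ j" using real_arch_pow[of "1 + e" "real n"] e by auto
  obtain Q where Q: "finite Q" "Q \<subseteq> carrier G"
    "\<And>A. finite A \<Longrightarrow> A \<subseteq> carrier G \<Longrightarrow> (1 + e) ^ j * card A \<le> card (A <#> Q)"
    using pow[of j] by blast
  have "n * card A \<le> card (A <#> Q)" if A: "finite A" "A \<subseteq> carrier G" for A
  proof -
    have "real (n * card A) \<le> (1 + e) ^ j * card A" using j by (simp add: mult_right_mono)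
    then have "real (n * card A) \<le> real (card (A <#> Q))" using Q(3)[OF A] by linarith
    then show ?thesis by linarith
  qed
  then show thesis using that Q by blast
qed

section \<open>Bounded displacement\<close>

lemma (in group) foldr_mult:
  "\<lbrakk>set l \<subseteq> carrier G; z \<in> carrier G\<rbrakk> \<Longrightarrow> foldr (\<otimes>) l z = foldr (\<otimes>) l \<one> \<otimes> z \<and> foldr (\<otimes>) l z \<in> carrier G"
  by (induction l) (simp_all add: m_assoc)

lemma (in group) prod_set_carrier: "T \<subseteq> carrier G \<Longrightarrow> prod_set G T n \<subseteq> carrier G"
  using foldr_mult[of _ \<one>] by (fastforce simp: prod_set_def)

lemma (in group) prod_set_add:
  assumes "T \<subseteq> carrier G" "x \<in> prod_set G T m" "y \<in> prod_set G T n"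
  shows "x \<otimes> y \<in> prod_set G T (m + n)"
proof -
  obtain l l' where l: "x = foldr (\<otimes>) l \<one>" "length l = m" "set l \<subseteq> T"
    and l': "y = foldr (\<otimes>) l' \<one>" "length l' = n" "set l' \<subseteq> T"
    using assms(2,3) by (auto simp: prod_set_def)
  have "y \<in> carrier G" using assms(1,3) prod_set_carrier by blast
  then have "foldr (\<otimes>) l y = x \<otimes> y" using foldr_mult[of l y] l assms(1) by auto
  then have "foldr (\<otimes>) (l @ l') \<one> = x \<otimes> y" by (simp add: l'(1))
  then show ?thesis using l l' unfolding prod_set_def
    by (intro CollectI exI[of _ "l @ l'"]) auto
qed

lemma (in group) prod_set_SucE:
  assumes "T \<subseteq> carrier G" "x \<in> prod_set G T (Suc n)"
  obtains y t where "y \<in> prod_set G T n" "t \<in> T" "x = y \<otimes> t"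
proof -
  obtain l where l: "x = foldr (\<otimes>) l \<one>" "length l = Suc n" "set l \<subseteq> T"
    using assms(2) by (auto simp: prod_set_def)
  then obtain l' t where lt: "l = l' @ [t]" by (cases l rule: rev_cases) auto
  then have t: "t \<in> carrier G" "set l' \<subseteq> carrier G" using l assms(1) by auto
  have "x = foldr (\<otimes>) l' \<one> \<otimes> t" using foldr_mult[OF t(2,1)] t l(1) lt by simp
  moreover have "foldr (\<otimes>) l' \<one> \<in> prod_set G T n" using l lt by (auto simp: prod_set_def)
  moreover have "t \<in> T" using l(3) lt by simp
  ultimately show thesis using that by blast
qed

lemma finite_prod_set: "finite T \<Longrightarrow> finite (prod_set G T n)"
proof -
  assume "finite T"
  then have "finite {l. set l \<subseteq> T \<and> length l = n}" by (rule finite_lists_length_eq)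
  moreover have "prod_set G T n = (\<lambda>l. foldr (\<otimes>\<^bsub>G\<^esub>) l \<one>\<^bsub>G\<^esub>) ` {l. set l \<subseteq> T \<and> length l = n}"
    by (auto simp: prod_set_def)
  ultimately show ?thesis by simp
qed

lemma (in group) generate_prod_set:
  assumes S: "S \<subseteq> carrier G" and x: "x \<in> generate G S"
  shows "\<exists>n. x \<in> prod_set G (S \<union> m_inv G ` S) n"
  using x
proof induction
  case one
  then show ?case by (intro exI[of _ 0]) (simp add: prod_set_def)
next
  case (incl h)
  then show ?case using S
    by (intro exI[of _ 1]) (auto simp: prod_set_def intro!: exI[of _ "[h]"])
next
  case (inv h)
  then show ?case using S
    by (intro exI[of _ 1]) (auto simp: prod_set_def intro!: exI[of _ "[inv h]"])
next
  case (eng h1 h2)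
  moreover have "S \<union> m_inv G ` S \<subseteq> carrier G" using S by auto
  ultimately show ?case using prod_set_add by blast
qed

text \<open>The distance depends only on \<open>inv x \<otimes> f x\<close>, and balls around the
  identity are finite. From here on displacement is handled through finite sets, without the
  metric.\<close>

lemma (in group) word_dist_bounded_iff:
  assumes "finite S" "S \<subseteq> carrier G" "generate G S = carrier G"
    and f: "\<And>x. x \<in> carrier G \<Longrightarrow> f x \<in> carrier G"
  shows "(\<exists>B. \<forall>x\<in>carrier G. word_dist G S x (f x) \<le> B) \<longleftrightarrow> finite ((\<lambda>x. inv x \<otimes> f x) ` carrier G)"
proof
  let ?T = "S \<union> m_inv G ` S"
  assume "\<exists>B. \<forall>x\<in>carrier G. word_dist G S x (f x) \<le> B"
  then obtain B where B: "\<And>x. x \<in> carrier G \<Longrightarrow> word_dist G S x (f x) \<le> B" by blast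
  have "inv x \<otimes> f x \<in> prod_set G ?T (word_dist G S x (f x))" if "x \<in> carrier G" for x
    unfolding word_dist_def
    by (rule LeastI_ex) (use generate_prod_set[OF assms(2)] assms(3) f that in auto)
  then have "(\<lambda>x. inv x \<otimes> f x) ` carrier G \<subseteq> (\<Union>n\<le>B. prod_set G ?T n)" using B by fast
  moreover have "finite (\<Union>n\<le>B. prod_set G ?T n)" using assms(1) by (simp add: finite_prod_set)
  ultimately show "finite ((\<lambda>x. inv x \<otimes> f x) ` carrier G)" by (rule finite_subset)
next
  let ?D = "(\<lambda>x. inv x \<otimes> f x) ` carrier G"
  define wl where "wl z = (LEAST n. z \<in> prod_set G (S \<union> m_inv G ` S) n)" for z
  assume "finite ?D"
  then have "word_dist G S x (f x) \<le> Max (wl ` ?D)" if "x \<in> carrier G" for x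
    using that unfolding word_dist_def wl_def[symmetric] by (intro Max_ge) auto
  then show "\<exists>B. \<forall>x\<in>carrier G. word_dist G S x (f x) \<le> B" by blast
qed

section \<open>Invariant means and free actions\<close>

lemma right_invariant_mean_Union:
  assumes \<nu>: "right_invariant_mean G \<nu>" and "finite I"
    and "\<And>i. i \<in> I \<Longrightarrow> B i \<subseteq> carrier G"
    and "\<And>i j. \<lbrakk>i \<in> I; j \<in> I; i \<noteq> j\<rbrakk> \<Longrightarrow> B i \<inter> B j = {}"
  shows "\<nu> (\<Union>i\<in>I. B i) = (\<Sum>i\<in>I. \<nu> (B i))"
  using assms(2-)
proof (induction I rule: finite_induct)
  case empty
  \<comment> \<open>Additivity on two empty sets forces the empty set to have mean 0.\<close>
  have "\<nu> ({} \<union> {}) = \<nu> {} + \<nu> {}" by (rule right_invariant_meanD(3)[OF \<nu>]) auto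
  then show ?case by simp
next
  case (insert i I)
  have "\<nu> (B i \<union> (\<Union>i\<in>I. B i)) = \<nu> (B i) + \<nu> (\<Union>i\<in>I. B i)"
    using insert.prems insert.hyps by (intro right_invariant_meanD(3)[OF \<nu>]) fastforce+
  then show ?case using insert by simp
qed

lemma right_invariant_mean_mono:
  assumes \<nu>: "right_invariant_mean G \<nu>" and "A \<subseteq> B" "B \<subseteq> carrier G"
  shows "\<nu> A \<le> \<nu> B"
proof -
  have "\<nu> (A \<union> (B - A)) = \<nu> A + \<nu> (B - A)"
    using assms by (intro right_invariant_meanD(3)[OF \<nu>]) auto
  moreover have "\<nu> (B - A) \<ge> 0" using assms by (intro right_invariant_meanD(1)[OF \<nu>]) auto
  ultimately show ?thesis using assms(2) by (simp add: Un_absorb1)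
qed

text \<open>A bounded injection is a piecewise right translation with finitely many pieces.\<close>

lemma (in group) right_invariant_mean_bounded_inj:
  assumes \<nu>: "right_invariant_mean G \<nu>"
    and f: "\<And>x. x \<in> carrier G \<Longrightarrow> f x \<in> carrier G" "inj_on f (carrier G)"
    and fin: "finite ((\<lambda>x. inv x \<otimes> f x) ` carrier G)"
    and Y: "Y \<subseteq> carrier G"
  shows "\<nu> {x \<in> carrier G. f x \<in> Y} \<le> \<nu> Y"
proof -
  let ?D = "(\<lambda>x. inv x \<otimes> f x) ` carrier G"
  define P where "P d = {x \<in> carrier G. f x \<in> Y \<and> inv x \<otimes> f x = d}" for d
  have D: "?D \<subseteq> carrier G" using f by auto
  have PG: "P d \<subseteq> carrier G" for d by (auto simp: P_def)
  have img: "(\<lambda>x. x \<otimes> d) ` P d = f ` P d" for d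
  proof (rule image_cong)
    fix x assume "x \<in> P d"
    then have x: "x \<in> carrier G" "d = inv x \<otimes> f x" by (auto simp: P_def)
    then show "x \<otimes> d = f x" using f(1)[OF x(1)] by (simp flip: m_assoc)
  qed simp
  have disj: "P d \<inter> P d' = {}" if "d \<noteq> d'" for d d' using that by (auto simp: P_def)
  have "\<nu> {x \<in> carrier G. f x \<in> Y} = \<nu> (\<Union>d\<in>?D. P d)"
    by (rule arg_cong[of _ _ \<nu>]) (auto simp: P_def)
  also have "\<dots> = (\<Sum>d\<in>?D. \<nu> (P d))"
    by (rule right_invariant_mean_Union[OF \<nu> fin]) (use PG disj in auto)
  also have "\<dots> = (\<Sum>d\<in>?D. \<nu> (f ` P d))"
  proof (rule sum.cong)
    fix d assume "d \<in> ?D"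
    then have "d \<in> carrier G" using D by blast
    then show "\<nu> (P d) = \<nu> (f ` P d)"
      using right_invariant_meanD(4)[OF \<nu> _ PG[of d]] by (simp flip: img)
  qed simp
  also have "\<dots> = \<nu> (\<Union>d\<in>?D. f ` P d)"
  proof (rule right_invariant_mean_Union[OF \<nu> fin, symmetric])
    show "f ` P d \<subseteq> carrier G" for d using Y by (auto simp: P_def)
    show "f ` P d \<inter> f ` P d' = {}" if "d \<noteq> d'" for d d'
      using inj_on_image_Int[OF f(2) PG[of d] PG[of d']] disj[OF that] by simp
  qed
  also have "\<dots> \<le> \<nu> Y"
    using Y by (intro right_invariant_mean_mono[OF \<nu>]) (auto simp: P_def)
  finally show ?thesis .
qed

text \<open>Fix a point in every orbit; the coordinate of \<open>x\<close> is the unique element of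
  \<open>H\<close> carrying that point to \<open>x\<close>. The resulting equivariant map pulls
  subsets of the free group back to \<open>G\<close>.\<close>

lemma free_action_coordinate:
  assumes H: "group H" and act: "right_action M H act"
    and free: "\<And>x h. \<lbrakk>x \<in> carrier M; h \<in> carrier H; act x h = x\<rbrakk> \<Longrightarrow> h = \<one>\<^bsub>H\<^esub>"
  obtains c where "\<And>x. x \<in> carrier M \<Longrightarrow> c x \<in> carrier H"
    "\<And>x h. \<lbrakk>x \<in> carrier M; h \<in> carrier H\<rbrakk> \<Longrightarrow> c (act x h) = c x \<otimes>\<^bsub>H\<^esub> h"
proof -
  interpret H: group H by fact
  have a1: "act x \<one>\<^bsub>H\<^esub> = x" if "x \<in> carrier M" for x
    using act that by (simp add: right_action_def)
  have aM: "act x h \<in> carrier M"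
    and am: "h' \<in> carrier H \<Longrightarrow> act x (h \<otimes>\<^bsub>H\<^esub> h') = act (act x h) h'"
    if "x \<in> carrier M" "h \<in> carrier H" for x h h'
    using act that by (simp_all add: right_action_def)
  have unique: "h = h'"
    if "x \<in> carrier M" "h \<in> carrier H" "h' \<in> carrier H" "act x h = act x h'" for x h h'
  proof -
    have "act x (h \<otimes>\<^bsub>H\<^esub> inv\<^bsub>H\<^esub> h') = act (act x h') (inv\<^bsub>H\<^esub> h')" using that by (simp add: am)
    also have "\<dots> = act x (h' \<otimes>\<^bsub>H\<^esub> inv\<^bsub>H\<^esub> h')" using that by (intro am[symmetric]) auto
    also have "\<dots> = x" using that a1 by simp
    finally have "h \<otimes>\<^bsub>H\<^esub> inv\<^bsub>H\<^esub> h' = \<one>\<^bsub>H\<^esub>" using free that by simp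
    then show ?thesis using that by (metis H.inv_closed H.inv_equality H.inv_inv)
  qed
  define orb where "orb x = act x ` carrier H" for x
  \<comment> \<open>The choice depends only on the orbit as a set, so equal orbits automatically
    share their representative.\<close>
  define rep where "rep x = (SOME y. y \<in> orb x)" for x
  have orb_sub: "orb (act x h) \<subseteq> orb x" if "x \<in> carrier M" "h \<in> carrier H" for x h
    using that by (auto simp: orb_def simp flip: am)
  have orb_eq: "orb (act x h) = orb x" if "x \<in> carrier M" "h \<in> carrier H" for x h
  proof
    have "act (act x h) (inv\<^bsub>H\<^esub> h) = x" using that a1 by (simp flip: am)
    then show "orb x \<subseteq> orb (act x h)"
      using orb_sub[of "act x h" "inv\<^bsub>H\<^esub> h"] that aM by simp
  qed (rule orb_sub[OF that])
  have rep: "\<exists>h\<in>carrier H. act (rep x) h = x" "rep x \<in> carrier M" if x: "x \<in> carrier M" for x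
  proof -
    have "act x \<one>\<^bsub>H\<^esub> \<in> orb x" by (auto simp: orb_def)
    then have "rep x \<in> orb x" unfolding rep_def by (rule someI)
    then obtain h where h: "h \<in> carrier H" "rep x = act x h" by (auto simp: orb_def)
    then show "rep x \<in> carrier M" using aM x by simp
    have "act (rep x) (inv\<^bsub>H\<^esub> h) = x" using h x a1 by (simp flip: am)
    then show "\<exists>h\<in>carrier H. act (rep x) h = x" using h(1) by blast
  qed
  define c where "c x = (SOME h. h \<in> carrier H \<and> act (rep x) h = x)" for x
  have c: "c x \<in> carrier H" "act (rep x) (c x) = x" if "x \<in> carrier M" for x
    using someI_ex[of "\<lambda>h. h \<in> carrier H \<and> act (rep x) h = x"] rep(1)[OF that]
    by (auto simp: c_def)
  have "c (act x h) = c x \<otimes>\<^bsub>H\<^esub> h" if "x \<in> carrier M" "h \<in> carrier H" for x h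
  proof (rule unique[of "rep x"])
    have "rep (act x h) = rep x" using orb_eq[OF that] by (simp add: rep_def)
    then show "act (rep x) (c (act x h)) = act (rep x) (c x \<otimes>\<^bsub>H\<^esub> h)"
      using c[of "act x h"] c[of x] that aM rep(2) by (simp add: am)
  qed (use that rep(2) c aM in auto)
  then show thesis using that c(1) by blast
qed

text \<open>The points whose coordinate ends in the letter \<open>a\<close> and those whose coordinate ends in its
  inverse have total mean at least 1; this holds for two different generators at once.\<close>

lemma (in group) translation_like_imp_nonamenable:
  assumes S: "finite S" "S \<subseteq> carrier G" "generate G S = carrier G"
    and k: "k \<ge> 2" and act: "translation_like G S (free_group k) act"
  shows "\<not> amenable G"
proof
  assume "amenable G"
  then obtain \<nu> where \<nu>: "right_invariant_mean G \<nu>"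
    using amenable_iff_right_invariant_mean by blast
  let ?F = "free_group k"
  have ra: "right_action G ?F act" using act by (simp add: translation_like_def)
  have "\<And>x h. \<lbrakk>x \<in> carrier G; h \<in> carrier ?F; act x h = x\<rbrakk> \<Longrightarrow> h = \<one>\<^bsub>?F\<^esub>"
    using act by (simp add: translation_like_def)
  then obtain c where c: "\<And>x. x \<in> carrier G \<Longrightarrow> c x \<in> carrier ?F"
    "\<And>x h. \<lbrakk>x \<in> carrier G; h \<in> carrier ?F\<rbrakk> \<Longrightarrow> c (act x h) = c x \<otimes>\<^bsub>?F\<^esub> h"
    using free_action_coordinate[OF group_free_group ra] by blast
  have aG: "act x h \<in> carrier G" if "x \<in> carrier G" "h \<in> carrier ?F" for x h
    using ra that by (simp add: right_action_def)
  define E where "E a = {x \<in> carrier G. c x \<noteq> [] \<and> last (c x) = a}" for a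
  have EG: "E a \<subseteq> carrier G" for a by (auto simp: E_def)
  have half: "1 \<le> \<nu> (E a) + \<nu> (E (letter_inv a))" if a: "fst a < k" for a
  proof -
    have aF: "[a] \<in> carrier ?F" "[letter_inv a] \<in> carrier ?F" using a by (auto simp: letter_in_free_group)
    have cancel: "act (act x [a]) [letter_inv a] = x" if "x \<in> carrier G" for x
    proof -
      have "act x ([a] \<otimes>\<^bsub>?F\<^esub> [letter_inv a]) = act (act x [a]) [letter_inv a]"
        using ra that aF by (simp add: right_action_def)
      moreover have "[a] \<otimes>\<^bsub>?F\<^esub> [letter_inv a] = \<one>\<^bsub>?F\<^esub>"
        by (simp add: mult_free_group one_free_group push_Cons del: push.simps(2))
      ultimately show ?thesis using ra that by (simp add: right_action_def)
    qed
    have "\<nu> {x \<in> carrier G. act x [a] \<in> E a} \<le> \<nu> (E a)"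
    proof (rule right_invariant_mean_bounded_inj[OF \<nu>])
      show "inj_on (\<lambda>x. act x [a]) (carrier G)" by (rule inj_on_inverseI[of _ "\<lambda>y. act y [letter_inv a]"]) (rule cancel)
      have "\<exists>B. \<forall>x\<in>carrier G. word_dist G S x (act x [a]) \<le> B"
        using act aF(1) by (simp add: translation_like_def)
      then show "finite ((\<lambda>x. inv x \<otimes> act x [a]) ` carrier G)"
        using word_dist_bounded_iff[OF S, of "\<lambda>x. act x [a]"] aG aF(1) by blast
    qed (use aG aF EG in auto)
    \<comment> \<open>If the coordinate does not end in the inverse of \<open>a\<close>, right
      multiplication by \<open>a\<close> appends \<open>a\<close> without cancelling.\<close>
    moreover have "carrier G - E (letter_inv a) \<subseteq> {x \<in> carrier G. act x [a] \<in> E a}"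
    proof
      fix x assume x: "x \<in> carrier G - E (letter_inv a)"
      then have "reduced (c x)" using c(1) by (simp add: carrier_free_group)
      then have "c (act x [a]) = c x @ [a]"
        using x c(2)[OF _ aF(1)] foldr_push_snoc[of "c x" a] by (auto simp: mult_free_group E_def)
      then show "x \<in> {x \<in> carrier G. act x [a] \<in> E a}" using x aG aF(1) by (simp add: E_def)
    qed
    then have "\<nu> (carrier G - E (letter_inv a)) \<le> \<nu> {x \<in> carrier G. act x [a] \<in> E a}"
      by (intro right_invariant_mean_mono[OF \<nu>]) auto
    moreover have "\<nu> (E (letter_inv a) \<union> (carrier G - E (letter_inv a))) =
        \<nu> (E (letter_inv a)) + \<nu> (carrier G - E (letter_inv a))"
      using EG by (intro right_invariant_meanD(3)[OF \<nu>]) auto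
    moreover have "E (letter_inv a) \<union> (carrier G - E (letter_inv a)) = carrier G" using EG by blast
    ultimately show ?thesis using right_invariant_meanD(2)[OF \<nu>] by simp
  qed
  \<comment> \<open>Generators 0 and 1 exist by \<open>k \<ge> 2\<close>. Their four classes are
    pairwise disjoint and have total mean at least 2, while the whole group has mean 1.\<close>
  let ?I = "{0, 1} \<times> UNIV :: (nat \<times> bool) set"
  have "\<nu> (\<Union>a\<in>?I. E a) = (\<Sum>a\<in>?I. \<nu> (E a))"
    by (rule right_invariant_mean_Union[OF \<nu>]) (auto simp: E_def)
  moreover have "\<nu> (\<Union>a\<in>?I. E a) \<le> \<nu> (carrier G)"
    using EG by (intro right_invariant_mean_mono[OF \<nu>]) auto
  moreover have "(\<Sum>a\<in>?I. \<nu> (E a)) =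
      (\<nu> (E (0, True)) + \<nu> (E (0, False))) + (\<nu> (E (1, True)) + \<nu> (E (1, False)))"
    by (simp add: sum.cartesian_product' UNIV_bool)
  ultimately show False
    using half[of "(0, True)"] half[of "(1, True)"] k right_invariant_meanD(2)[OF \<nu>]
    by (simp add: letter_inv_def)
qed

section \<open>Hall's theorem\<close>

text \<open>A minimal subrelation that still satisfies Hall's condition is shown to be the graph of
  an injection on \<open>I\<close>. Zorn's lemma provides it, since Hall's condition passes to
  intersections of chains when every row is finite.\<close>

lemma infinite_Hall:
  fixes R :: "('i \<times> 'x) set"
  assumes fin: "\<And>i. finite (R `` {i})"
    and hall: "\<And>A. finite A \<Longrightarrow> A \<subseteq> I \<Longrightarrow> card A \<le> card (R `` A)"
  obtains f where "inj_on f I" "\<And>i. i \<in> I \<Longrightarrow> (i, f i) \<in> R"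
proof -
  define H where "H = {Q. Q \<subseteq> R \<and> (\<forall>A. finite A \<longrightarrow> A \<subseteq> I \<longrightarrow> card A \<le> card (Q `` A))}"
  have finQ: "finite (Q `` A)" if "Q \<subseteq> R" "finite A" for Q A
  proof -
    have "Q `` A \<subseteq> (\<Union>i\<in>A. R `` {i})" using that by auto
    then show ?thesis using fin that(2) by (meson finite_UN_I finite_subset)
  qed
  have "\<exists>M\<in>H. \<forall>Q\<in>H. Q \<subseteq> M \<longrightarrow> Q = M"
  proof -
    have RH: "R \<in> H" using hall by (auto simp: H_def)
    have lower: "\<Inter>C \<in> H" if C: "subset.chain H C" "C \<noteq> {}" for C
    proof -
      have sub: "Q \<subseteq> R" if "Q \<in> C" for Q using C(1) that by (auto simp: H_def subset_chain_def)
      have "card A \<le> card ((\<Inter>C) `` A)" if A: "finite A" "A \<subseteq> I" for A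
      proof -
        \<comment> \<open>Only finitely many pairs of \<open>R\<close> over \<open>A\<close> are
          missing from the intersection. One chain member omitting each of them gives a finite
          subchain, whose intersection is its least member.\<close>
        have "\<exists>D. finite D \<and> D \<subseteq> C \<and> D \<noteq> {} \<and> (\<Inter>D) `` A \<subseteq> (\<Inter>C) `` A"
        proof -
          let ?P = "(SIGMA i:A. R `` {i}) - \<Inter>C"
          have finP: "finite ?P" using A(1) fin by auto
          have "\<forall>z\<in>?P. \<exists>Q\<in>C. z \<notin> Q" by auto
          then obtain g where g: "\<And>z. z \<in> ?P \<Longrightarrow> g z \<in> C \<and> z \<notin> g z" by metis
          obtain Q0 where "Q0 \<in> C" using C(2) by blast
          let ?D = "insert Q0 (g ` ?P)"
          have "(\<Inter>?D) `` A \<subseteq> (\<Inter>C) `` A"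
          proof
            fix x assume "x \<in> (\<Inter>?D) `` A"
            then obtain i where i: "i \<in> A" "(i, x) \<in> \<Inter>?D" by auto
            have "(i, x) \<in> R" using i(2) sub[OF \<open>Q0 \<in> C\<close>] by auto
            then have "(i, x) \<notin> ?P" using i(2) g[of "(i,x)"] by blast
            then have "(i, x) \<in> \<Inter>C" using i(1) \<open>(i, x) \<in> R\<close> by blast
            then show "x \<in> (\<Inter>C) `` A" using i(1) by blast
          qed
          moreover have "finite ?D" "?D \<subseteq> C" "?D \<noteq> {}" using finP \<open>Q0 \<in> C\<close> g by auto
          ultimately show ?thesis by blast
        qed
        then obtain D where D: "finite D" "D \<subseteq> C" "D \<noteq> {}" "(\<Inter>D) `` A \<subseteq> (\<Inter>C) `` A" by blast
        have "subset.chain H D" using C(1) D(2) by (meson subset_chain_def subset_iff)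
        then have "\<Inter>D \<in> C" using Inter_in_chain D(1-3) by blast
        then have "\<Inter>D \<in> H" using C(1) by (auto simp: subset_chain_def)
        then have "card A \<le> card ((\<Inter>D) `` A)" using A by (auto simp: H_def)
        also have "\<dots> \<le> card ((\<Inter>C) `` A)"
        proof (rule card_mono[OF finQ[OF _ A(1)] D(4)])
          show "\<Inter>C \<subseteq> R" using C(2) sub by blast
        qed
        finally show ?thesis .
      qed
      moreover have "\<Inter>C \<subseteq> R" using C(2) sub by blast
      ultimately show ?thesis by (simp add: H_def)
    qed
    \<comment> \<open>Complements turn the maximal element of Zorn's lemma into a minimal
      one.\<close>
    have "\<exists>M\<in>uminus ` H. \<forall>Z\<in>uminus ` H. M \<subseteq> Z \<longrightarrow> Z = M"
    proof (rule subset_Zorn)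
      fix C assume C: "subset.chain (uminus ` H) C"
      show "\<exists>U\<in>uminus ` H. \<forall>Z\<in>C. Z \<subseteq> U"
      proof (cases "C = {}")
        case True
        then show ?thesis using RH by auto
      next
        case False
        have "subset.chain H (uminus ` C)"
          using C by (fastforce simp: subset_chain_def)
        then have "\<Inter>(uminus ` C) \<in> H" using lower False by auto
        then have "- \<Inter>(uminus ` C) \<in> uminus ` H" by blast
        then show ?thesis by (rule bexI[rotated]) auto
      qed
    qed
    then show ?thesis by auto
  qed
  then obtain M where M: "M \<in> H" and minM: "\<And>Q. Q \<in> H \<Longrightarrow> Q \<subseteq> M \<Longrightarrow> Q = M" by blast
  have MR: "M \<subseteq> R" and hallM: "\<And>A. finite A \<Longrightarrow> A \<subseteq> I \<Longrightarrow> card A \<le> card (M `` A)"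
    using M by (auto simp: H_def)
  \<comment> \<open>Removing a pair from the minimal relation creates a violating set, which must contain \<open>i\<close>.\<close>
  have viol: "\<exists>A. finite A \<and> A \<subseteq> I \<and> i \<notin> A \<and> card (M `` A \<union> (M `` {i} - {x})) \<le> card A"
    if "(i, x) \<in> M" for i x
  proof -
    let ?Q = "M - {(i, x)}"
    have "?Q \<notin> H" using minM[of ?Q] that by auto
    then obtain A where A: "finite A" "A \<subseteq> I" "card (?Q `` A) < card A"
      using MR by (auto simp: H_def not_le)
    have "i \<in> A"
    proof (rule ccontr)
      assume "i \<notin> A"
      then have "?Q `` A = M `` A" by auto
      then show False using A hallM[of A] by simp
    qed
    moreover have "?Q `` A = M `` (A - {i}) \<union> (M `` {i} - {x})" using \<open>i \<in> A\<close> by auto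
    ultimately show ?thesis using A
      by (intro exI[of _ "A - {i}"]) auto
  qed
  have single: "x = y" if x: "(i, x) \<in> M" and y: "(i, y) \<in> M" and i: "i \<in> I" for i x y
  proof (rule ccontr)
    assume ne: "x \<noteq> y"
    obtain A where A: "finite A" "A \<subseteq> I" "i \<notin> A" "card (M `` A \<union> (M `` {i} - {x})) \<le> card A"
      using viol[OF x] by blast
    obtain B where B: "finite B" "B \<subseteq> I" "i \<notin> B" "card (M `` B \<union> (M `` {i} - {y})) \<le> card B"
      using viol[OF y] by blast
    \<comment> \<open>Submodular counting: since \<open>x \<noteq> y\<close>, the union of
      \<open>?U\<close> and \<open>?V\<close> recovers the whole row of \<open>i\<close>, so Hall's
      condition bounds it below by one more than \<open>card (A \<union> B)\<close>. Adding the
      bound for the intersection contradicts the sizes of \<open>?U\<close> and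
      \<open>?V\<close>.\<close>
    let ?U = "M `` A \<union> (M `` {i} - {x})" and ?V = "M `` B \<union> (M `` {i} - {y})"
    have f: "finite ?U" "finite ?V" using finQ[OF MR] A(1) B(1) by auto
    have "card (insert i (A \<union> B)) \<le> card (M `` (insert i (A \<union> B)))"
      using A B i by (intro hallM) auto
    also have "M `` (insert i (A \<union> B)) = ?U \<union> ?V" using ne by auto
    finally have 1: "Suc (card (A \<union> B)) \<le> card (?U \<union> ?V)" using A B by simp
    have "card (A \<inter> B) \<le> card (M `` (A \<inter> B))" using A B by (intro hallM) auto
    also have "\<dots> \<le> card (?U \<inter> ?V)" using f by (intro card_mono) auto
    finally have 2: "card (A \<inter> B) \<le> card (?U \<inter> ?V)" .
    show False
      using 1 2 A(4) B(4) card_Un_Int[OF f] card_Un_Int[OF A(1) B(1)] by linarith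
  qed
  have ex: "\<exists>x. (i, x) \<in> M" if "i \<in> I" for i
  proof (rule ccontr)
    assume "\<not> ?thesis"
    then have "M `` {i} = {}" by auto
    then show False using hallM[of "{i}"] that by simp
  qed
  define f where "f i = (SOME x. (i, x) \<in> M)" for i
  have f: "(i, f i) \<in> M" if "i \<in> I" for i
    using someI_ex[OF ex[OF that]] by (simp add: f_def)
  have "inj_on f I"
  proof (rule inj_onI, rule ccontr)
    fix i j assume ij: "i \<in> I" "j \<in> I" "f i = f j" "i \<noteq> j"
    have "(i, f i) \<in> M" "(j, f i) \<in> M" using f[of i] f[of j] ij by simp_all
    then have "M `` {i, j} = {f i}" using single ij(1,2) by blast
    then show False using hallM[of "{i, j}"] ij by simp
  qed
  then show thesis using that f MR by blast
qed

section \<open>Rooted trees\<close>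

text \<open>\<open>p\<close> agrees with \<open>f\<close> off the forward orbits of the base points,
  so \<open>v\<close> loses only preimages on such an orbit. The set \<open>E\<close> collects
  these, and there are at most two because the orbit is a ray or runs into a single cycle. The
  option \<open>f (p x) = x\<close> describes reversed edges.\<close>

lemma rooted_reorientation:
  fixes f q :: "'a \<Rightarrow> 'a" and len :: "'a \<Rightarrow> nat"
  assumes f: "\<And>x. x \<in> V \<Longrightarrow> f x \<in> V"
    and q: "\<And>x. x \<in> V \<Longrightarrow> x \<noteq> r \<Longrightarrow> q x \<in> V \<and> len (q x) < len x"
    and r: "r \<in> V" "len r = 0"
  shows "\<exists>p. (\<forall>x\<in>V. x \<noteq> r \<longrightarrow> p x \<in> V \<and> (p x = f x \<or> p x = q x \<or> f (p x) = x)) \<and>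
    (\<forall>x\<in>V. \<exists>j. (p ^^ j) x = r) \<and> p r = r \<and>
    (\<forall>v\<in>V. \<exists>E. finite E \<and> card E \<le> 2 \<and> (\<forall>x\<in>V - E. f x = v \<longrightarrow> x \<noteq> r \<and> p x = v))"
proof -
  \<comment> \<open>Components of \<open>f\<close>: two points are related when their forward orbits
    meet.\<close>
  define rel where "rel x y \<longleftrightarrow> (\<exists>a b. (f ^^ a) x = (f ^^ b) y)" for x y
  define base where
    "base x = (SOME y. y \<in> V \<and> rel x y \<and> (\<forall>z\<in>V. rel x z \<longrightarrow> len y \<le> len z))" for x
  \<comment> \<open>The orbit may revisit \<open>x\<close>. Taking the first visit makes
    \<open>idx\<close> drop along reversed edges, so they lead to the base point even when the orbit
    is periodic.\<close>
  define idx where "idx x = (LEAST i. (f ^^ i) (base x) = x)" for x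
  define fwd where "fwd x \<longleftrightarrow> (\<exists>i. (f ^^ i) (base x) = x)" for x
  define p where "p x = (if x = r then r else if \<not> fwd x then f x else
    if idx x = 0 then q x else (f ^^ (idx x - 1)) (base x))" for x
  have rel_sym: "rel x y \<Longrightarrow> rel y x" for x y unfolding rel_def by metis
  have rel_trans: "rel x z" if xyz: "rel x y" "rel y z" for x y z
  proof -
    obtain a b c d where ab: "(f ^^ a) x = (f ^^ b) y" and cd: "(f ^^ c) y = (f ^^ d) z"
      using xyz unfolding rel_def by blast
    have "(f ^^ (c + a)) x = (f ^^ (c + b)) y" by (simp add: funpow_add ab)
    also have "\<dots> = (f ^^ (b + d)) z" by (simp only: add.commute[of c]) (simp add: funpow_add cd)
    finally show ?thesis unfolding rel_def by blast
  qed
  have rel_refl: "rel x x" for x unfolding rel_def by blast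
  have rel_f: "rel x ((f ^^ i) x)" for x i
    unfolding rel_def by (rule exI[of _ i], rule exI[of _ 0]) simp
  have fX: "(f ^^ i) x \<in> V" if "x \<in> V" for i x by (induction i) (auto intro: f that)
  have base: "base x \<in> V" "rel x (base x)" "\<And>z. z \<in> V \<Longrightarrow> rel x z \<Longrightarrow> len (base x) \<le> len z"
    if "x \<in> V" for x
  proof -
    have "\<exists>y. (y \<in> V \<and> rel x y) \<and> (\<forall>z. z \<in> V \<and> rel x z \<longrightarrow> len y \<le> len z)"
      using that rel_refl by (intro ex_has_least_nat[of _ x]) auto
    then have "\<exists>y. y \<in> V \<and> rel x y \<and> (\<forall>z\<in>V. rel x z \<longrightarrow> len y \<le> len z)" by blast
    from someI_ex[OF this] show "base x \<in> V" "rel x (base x)"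
      "\<And>z. z \<in> V \<Longrightarrow> rel x z \<Longrightarrow> len (base x) \<le> len z"
      unfolding base_def by auto
  qed
  have base_eq: "base x = base y" if "rel x y" for x y
  proof -
    have "rel x = rel y" using that rel_sym rel_trans by blast
    then show ?thesis by (simp add: base_def)
  qed
  have base_f: "base (f x) = base x" for x
    using base_eq[OF rel_f[of x 1]] by simp
  have base_base: "base (base x) = base x" if "x \<in> V" for x
    using base_eq[OF base(2)[OF that]] by simp
  have base_fn: "base ((f ^^ i) x) = base x" for i x
    using base_eq[OF rel_f] by simp
  have idx: "(f ^^ idx x) (base x) = x" if "fwd x" for x
    using that unfolding fwd_def idx_def by (rule LeastI_ex)
  have idx_le: "idx x \<le> i" if "(f ^^ i) (base x) = x" for x i
    unfolding idx_def by (rule Least_le) (rule that)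
  have fwd_fn: "fwd ((f ^^ i) (base x))" and idx_fn: "idx ((f ^^ i) (base x)) \<le> i" if "x \<in> V" for i x
    using base_fn base_base[OF that] idx_le by (auto simp: fwd_def)
  \<comment> \<open>Only \<open>r\<close> can have length 0, because \<open>q\<close> strictly
    lowers the length elsewhere; so \<open>r\<close> is the base of its own component.\<close>
  have base_r: "base r = r"
    using base(1,3)[OF r(1)] r rel_refl[of r] q by fastforce
  have fwd_r: "fwd r" unfolding fwd_def by (rule exI[of _ 0]) (simp add: base_r)
  have p1: "p x \<in> V \<and> (p x = f x \<or> p x = q x \<or> f (p x) = x)" if x: "x \<in> V" "x \<noteq> r" for x
  proof -
    consider "\<not> fwd x" | "fwd x" "idx x = 0" | i where "fwd x" "idx x = Suc i"
      by (cases "idx x") auto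
    then show ?thesis
    proof cases
      case 3
      then have "f ((f ^^ i) (base x)) = x" using idx[of x] by simp
      then show ?thesis using 3 x fX base(1) by (simp add: p_def)
    qed (use x f q in \<open>auto simp: p_def\<close>)
  qed
  have step: "\<exists>j. (p ^^ j) x = r" if "\<exists>j. (p ^^ j) (p x) = r" for x
    using that by (metis comp_apply funpow_Suc_right)
  have reach: "\<exists>j. (p ^^ j) x = r" if "x \<in> V" for x
    using that
  \<comment> \<open>Three nested descents: off the orbit \<open>f\<close> leads onto it, on the
    orbit \<open>idx\<close> decreases to the base, and from the base \<open>q\<close> enters a
    component whose base is strictly shorter.\<close>
  proof (induction "len (base x)" arbitrary: x rule: less_induct)
    case less
    note outer = less
    have on_fwd: "\<exists>j. (p ^^ j) y = r" if "y \<in> V" "base y = base x" "fwd y" for y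
      using that
    proof (induction "idx y" arbitrary: y rule: less_induct)
      case less
      show ?case
      proof (cases "y = r")
        case True
        then show ?thesis by (intro exI[of _ 0]) simp
      next
        case False
        show ?thesis
        proof (cases "idx y")
          case 0
          have "base y = y" using idx[OF less.prems(3)] 0 by simp
          have qy: "q y \<in> V" "len (q y) < len y" using q less.prems False by auto
          have "len (base (q y)) < len (base x)"
            using base(3)[OF qy(1) qy(1) rel_refl] qy(2) \<open>base y = y\<close> less.prems by simp
          then have "\<exists>j. (p ^^ j) (q y) = r" using outer(1) qy(1) by blast
          then show ?thesis using step[of y] 0 False less.prems by (simp add: p_def)
        next
          case (Suc i)
          let ?z = "(f ^^ i) (base y)"
          have "p y = ?z" using Suc False less.prems by (simp add: p_def)
          moreover have "idx ?z < idx y" using idx_fn[OF less.prems(1), of i] Suc by simp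
          ultimately show ?thesis
            using step[of y] less.hyps[of ?z] less.prems fX base(1) base_fn base_base fwd_fn by metis
        qed
      qed
    qed
    have off_fwd: "\<exists>j. (p ^^ j) y = r" if "y \<in> V" "base y = base x" "fwd ((f ^^ a) y)" for a y
      using that
    proof (induction a arbitrary: y)
      case (Suc a)
      show ?case
      proof (cases "fwd y")
        case False
        then have "p y = f y" using fwd_r by (auto simp: p_def)
        moreover have "\<exists>j. (p ^^ j) (f y) = r"
          using Suc.prems f base_f by (intro Suc.IH) (simp_all add: funpow_swap1)
        ultimately show ?thesis using step by metis
      qed (use on_fwd Suc in blast)
    qed (use on_fwd in simp)
    obtain a b where "(f ^^ a) x = (f ^^ b) (base x)"
      using base(2)[OF less.prems] unfolding rel_def by blast
    then have "fwd ((f ^^ a) x)" using fwd_fn[OF less.prems] by simp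
    then show ?case using off_fwd less.prems by blast
  qed
  have kids: "\<exists>E. finite E \<and> card E \<le> 2 \<and> (\<forall>x\<in>V - E. f x = v \<longrightarrow> x \<noteq> r \<and> p x = v)" if "v \<in> V" for v
  proof -
    define E where "E = {x \<in> V. fwd x \<and> f x = v}"
    have baseE: "base x = base v" if "x \<in> E" for x
      using that base_f by (auto simp: E_def)
    have "\<exists>x0 x1. E \<subseteq> {x0, x1}"
    proof (cases "E = {}")
      case False
      then obtain x0 where x0: "x0 \<in> E" "\<And>y. y \<in> E \<Longrightarrow> idx x0 \<le> idx y"
        using ex_has_least_nat[of "\<lambda>x. x \<in> E" _ idx] by blast
      show ?thesis
      proof (cases "E \<subseteq> {x0}")
        case False
        then have "\<exists>y. y \<in> E - {x0}" by blast
        then obtain x1 where x1: "x1 \<in> E - {x0}" "\<And>y. y \<in> E - {x0} \<Longrightarrow> idx x1 \<le> idx y"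
          using ex_has_least_nat[of "\<lambda>x. x \<in> E - {x0}" _ idx] by blast
        let ?b = "base v"
        have i: "(f ^^ idx x) ?b = x" if "x \<in> E" for x
          using that idx baseE by (fastforce simp: E_def)
        have lt: "idx x0 < idx x1"
          using x0 x1 i by (metis DiffE insertI1 le_neq_implies_less)
        have eq: "(f ^^ Suc (idx x0)) ?b = (f ^^ Suc (idx x1)) ?b"
          using i x0(1) x1(1) by (simp add: E_def)
        \<comment> \<open>The orbit reaches \<open>v\<close> after both \<open>Suc (idx x0)\<close>
          and \<open>Suc (idx x1)\<close> steps, so it repeats from there. Every orbit point
          therefore occurs by time \<open>idx x1\<close>, which leaves no index for a third
          preimage.\<close>
        have per: "\<exists>c'\<le>idx x1. (f ^^ c) ?b = (f ^^ c') ?b" for c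
        proof (induction c)
          case (Suc c)
          then obtain c' where c': "c' \<le> idx x1" "(f ^^ c) ?b = (f ^^ c') ?b" by blast
          then have *: "(f ^^ Suc c) ?b = (f ^^ Suc c') ?b" by simp
          show ?case
          proof (cases "c' = idx x1")
            case True
            then show ?thesis using * eq lt by (metis Suc_leI)
          next
            case False
            then show ?thesis using * c'(1) by (intro exI[of _ "Suc c'"]) auto
          qed
        qed auto
        have "x \<in> {x0, x1}" if x: "x \<in> E" for x
        proof (rule ccontr)
          assume ne: "x \<notin> {x0, x1}"
          then have "idx x1 \<le> idx x" using x1(2) x by blast
          moreover have "idx x \<noteq> idx x1" using i[OF x] i[of x1] x1(1) ne by auto
          moreover obtain c' where "c' \<le> idx x1" "x = (f ^^ c') ?b"
            using per[of "idx x"] i[OF x] by auto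
          then have "idx x \<le> idx x1" using idx_le[of c' x] baseE[OF x] by simp
          ultimately show False by simp
        qed
        then show ?thesis by blast
      qed blast
    qed auto
    then obtain x0 x1 where E: "E \<subseteq> {x0, x1}" by blast
    have "card E \<le> card {x0, x1}" using E by (intro card_mono) auto
    also have "\<dots> \<le> 2" by (simp add: card_insert_if)
    finally have "card E \<le> 2" .
    moreover have "finite E" using E finite_subset by blast
    moreover have "x \<noteq> r \<and> p x = v" if "x \<in> V - E" "f x = v" for x
    proof -
      have "\<not> fwd x" using that by (auto simp: E_def)
      then show ?thesis using that fwd_r by (auto simp: p_def)
    qed
    ultimately show ?thesis by blast
  qed
  have "p r = r" by (simp add: p_def)
  then show ?thesis
    using p1 reach kids by (intro exI[of _ p] conjI ballI impI) simp_all
qed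

section \<open>Redistributing the children of a rooted tree\<close>

definition deal :: "nat \<Rightarrow> 'a list \<Rightarrow> nat \<Rightarrow> 'a list" where
  "deal m xs j = (if Suc j < m then [xs ! j] else drop (m - 1) xs)"

text \<open>All surplus goes to the last slot, so long lists leave no slot empty. The same holds
  with \<open>m - 1\<close> slots, as needed once slot 0 is taken by the siblings; this explains the
  bound \<open>2 \<le> m\<close> below.\<close>

lemma deal_nonempty: "\<lbrakk>m \<le> length xs; 0 < m\<rbrakk> \<Longrightarrow> deal m xs j \<noteq> []"
  by (auto simp: deal_def)

lemma set_deal: "\<lbrakk>m \<le> length xs; j < m\<rbrakk> \<Longrightarrow> set (deal m xs j) \<subseteq> set xs"
  by (auto simp: deal_def dest: in_set_dropD)

lemma distinct_deal: "distinct xs \<Longrightarrow> distinct (deal m xs j)"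
  by (simp add: deal_def)

lemma deal_disjoint:
  assumes "distinct xs" "m \<le> length xs" "i < j" "j < m"
  shows "set (deal m xs i) \<inter> set (deal m xs j) = {}"
proof -
  have "xs ! i \<noteq> xs ! j" using assms by (simp add: nth_eq_iff_index_eq)
  moreover have "xs ! i \<notin> set (drop (m - 1) xs)" if "Suc j = m"
  proof
    assume "xs ! i \<in> set (drop (m - 1) xs)"
    then obtain l where "l < length xs - (m - 1)" "xs ! i = xs ! (m - 1 + l)"
      using assms by (auto simp: in_set_conv_nth)
    then show False using assms by (simp add: nth_eq_iff_index_eq)
  qed
  ultimately show ?thesis using assms by (auto simp: deal_def)
qed

lemma deal_cover:
  assumes "x \<in> set xs" "m \<le> length xs" "0 < m"
  shows "\<exists>j<m. x \<in> set (deal m xs j)"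
proof -
  obtain i where i: "i < length xs" "x = xs ! i" using assms(1) by (auto simp: in_set_conv_nth)
  show ?thesis
  proof (cases "Suc i < m")
    case True
    then show ?thesis using i by (intro exI[of _ i]) (auto simp: deal_def)
  next
    case False
    then have "drop (m - 1) xs ! (i - (m - 1)) = x" "i - (m - 1) < length (drop (m - 1) xs)"
      using i assms by auto
    then have "x \<in> set (drop (m - 1) xs)" by (metis nth_mem)
    then show ?thesis using assms by (intro exI[of _ "m - 1"]) (auto simp: deal_def)
  qed
qed

text \<open>The head of a list of siblings gets as first child its next sibling, which carries the rest
  of the list, and its own children are dealt to the remaining slots. Since siblings never mix with
  nephews, all displacements stay bounded.\<close>

definition offspring :: "('a \<Rightarrow> 'a list) \<Rightarrow> nat \<Rightarrow> 'a list \<Rightarrow> nat \<Rightarrow> 'a list" where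
  "offspring ch m xs j =
     (if tl xs = [] then deal m (ch (hd xs)) j
      else if j = 0 then tl xs else deal (m - 1) (ch (hd xs)) (j - 1))"

lemma offspring_nonempty:
  assumes "2 \<le> m" "m \<le> length (ch (hd xs))"
  shows "offspring ch m xs j \<noteq> []"
  using assms deal_nonempty[of m "ch (hd xs)"] deal_nonempty[of "m - 1" "ch (hd xs)"]
  by (simp add: offspring_def)

lemma distinct_offspring:
  "\<lbrakk>distinct xs; distinct (ch (hd xs))\<rbrakk> \<Longrightarrow> distinct (offspring ch m xs j)"
  by (simp add: offspring_def distinct_deal distinct_tl)

lemma set_offspring:
  assumes "2 \<le> m" "m \<le> length (ch (hd xs))" "j < m"
  shows "set (offspring ch m xs j) \<subseteq> set (tl xs) \<or> set (offspring ch m xs j) \<subseteq> set (ch (hd xs))"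
  using assms set_deal[of m "ch (hd xs)" j] set_deal[of "m - 1" "ch (hd xs)" "j - 1"]
  by (auto simp: offspring_def)

text \<open>Only slot 0 can carry siblings, so the higher slot \<open>j\<close> always consists of
  children of the head. This asymmetry is why the two slots are ordered.\<close>

lemma offspring_disjoint:
  assumes "2 \<le> m" "m \<le> length (ch (hd xs))" "distinct (ch (hd xs))" "i < j" "j < m"
  shows "set (offspring ch m xs j) \<subseteq> set (ch (hd xs)) \<and>
    (set (offspring ch m xs i) \<subseteq> set (tl xs) \<or>
     set (offspring ch m xs i) \<subseteq> set (ch (hd xs)) \<and>
     set (offspring ch m xs i) \<inter> set (offspring ch m xs j) = {})"
proof (cases "tl xs = []")
  case True
  then show ?thesis
    using assms deal_disjoint[of "ch (hd xs)" m i j] set_deal[of m "ch (hd xs)" i]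
      set_deal[of m "ch (hd xs)" j]
    by (simp add: offspring_def)
next
  case False
  have j: "set (deal (m - 1) (ch (hd xs)) (j - 1)) \<subseteq> set (ch (hd xs))"
    using assms by (intro set_deal) auto
  show ?thesis
  proof (cases "i = 0")
    case True
    then show ?thesis using assms j False by (simp add: offspring_def)
  next
    case i: False
    have "set (deal (m - 1) (ch (hd xs)) (i - 1)) \<subseteq> set (ch (hd xs))"
      using assms i by (intro set_deal) auto
    moreover have "set (deal (m - 1) (ch (hd xs)) (i - 1)) \<inter> set (deal (m - 1) (ch (hd xs)) (j - 1)) = {}"
      using assms i by (intro deal_disjoint) auto
    ultimately show ?thesis using assms j False i by (simp add: offspring_def)
  qed
qed

lemma offspring_cover:
  assumes "x \<in> set (ch (hd xs))" "2 \<le> m" "m \<le> length (ch (hd xs))"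
  shows "\<exists>j<m. x \<in> set (offspring ch m xs j)"
proof (cases "tl xs = []")
  case True
  then show ?thesis using assms deal_cover[of x "ch (hd xs)" m] by (simp add: offspring_def)
next
  case False
  obtain j where "j < m - 1" "x \<in> set (deal (m - 1) (ch (hd xs)) j)"
    using assms deal_cover[of x "ch (hd xs)" "m - 1"] by fastforce
  then show ?thesis using False by (intro exI[of _ "Suc j"]) (simp add: offspring_def)
qed

text \<open>\<open>W\<close> is an abstract tree of words in which \<open>m w\<close> letters may
  follow \<open>w\<close>, numbered by \<open>rk w\<close>. The count varies with \<open>w\<close>
  because in a free group the empty word has one more successor than the other words. Each
  \<open>w\<close> carries a list of siblings, and its head is the vertex assigned to
  \<open>w\<close>.\<close>

theorem tree_regularization:
  fixes p :: "'a \<Rightarrow> 'a" and W :: "'l list set" and rk :: "'l list \<Rightarrow> 'l \<Rightarrow> nat"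
  assumes r: "r \<in> V" "p r = r"
    and reach: "\<And>x. x \<in> V \<Longrightarrow> \<exists>j. (p ^^ j) x = r"
    and pV: "\<And>x. x \<in> V \<Longrightarrow> p x \<in> V"
    and fin: "\<And>v. v \<in> V \<Longrightarrow> finite {x \<in> V. x \<noteq> r \<and> p x = v}"
    and many: "\<And>v. v \<in> V \<Longrightarrow> N \<le> card {x \<in> V. x \<noteq> r \<and> p x = v}"
    and W: "[] \<in> W" "\<And>w a. w @ [a] \<in> W \<longleftrightarrow> w \<in> W \<and> a \<in> A w"
    and rk: "\<And>w. w \<in> W \<Longrightarrow> bij_betw (rk w) (A w) {..<m w}"
    and m: "\<And>w. w \<in> W \<Longrightarrow> 2 \<le> m w \<and> m w \<le> N"
  obtains g where "bij_betw g W V"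
    "\<And>w a. w @ [a] \<in> W \<Longrightarrow> p (g (w @ [a])) = g w \<or> p (g (w @ [a])) = p (g w)"
proof -
  define kids where "kids v = {x \<in> V. x \<noteq> r \<and> p x = v}" for v
  define ch where "ch v = (SOME xs. distinct xs \<and> set xs = kids v)" for v
  have ch: "distinct (ch v)" "set (ch v) = kids v" "N \<le> length (ch v)" if "v \<in> V" for v
  proof -
    have "\<exists>xs. distinct xs \<and> set xs = kids v"
      using finite_distinct_list[OF fin[OF that]] by (auto simp: kids_def)
    from someI_ex[OF this] show d: "distinct (ch v)" "set (ch v) = kids v"
      unfolding ch_def by auto
    show "N \<le> length (ch v)"
      using many[OF that] d distinct_card[of "ch v"] by (simp add: kids_def)
  qed
  \<comment> \<open>Words grow at the right end, so the recursion runs over the reversed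
    word.\<close>
  define L where
    "L w = rec_list [r] (\<lambda>a v Lv. offspring ch (m (rev v)) Lv (rk (rev v) a)) (rev w)" for w
  have L_Nil: "L [] = [r]" and L_snoc: "L (w @ [a]) = offspring ch (m w) (L w) (rk w a)" for w a
    by (simp_all add: L_def)
  have rk_less: "rk w a < m w" if "w @ [a] \<in> W" for w a
    using that rk[of w] W(2)[of w a] by (auto simp: bij_betw_def)
  have inv: "L w \<noteq> [] \<and> distinct (L w) \<and> set (L w) \<subseteq> V \<and> (L w = [r] \<or> (\<exists>u\<in>V. set (L w) \<subseteq> kids u))"
    if "w \<in> W" for w
    using that
  proof (induction w rule: rev_induct)
    case Nil
    then show ?case using r by (simp add: L_Nil)
  next
    case (snoc a w)
    have w: "w \<in> W" using snoc.prems W(2) by blast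
    have IH: "L w \<noteq> []" "distinct (L w)" "set (L w) \<subseteq> V"
      "L w = [r] \<or> (\<exists>u\<in>V. set (L w) \<subseteq> kids u)" using snoc.IH[OF w] by auto
    have hd: "hd (L w) \<in> V" using IH by auto
    have mw: "2 \<le> m w" "m w \<le> length (ch (hd (L w)))" using m[OF w] ch(3)[OF hd] by auto
    have step: "set (L (w @ [a])) \<subseteq> set (tl (L w)) \<or> set (L (w @ [a])) \<subseteq> kids (hd (L w))"
      using set_offspring[of "m w" ch "L w" "rk w a"] mw rk_less[OF snoc.prems] ch(2)[OF hd]
      by (simp add: L_snoc)
    have ne: "L (w @ [a]) \<noteq> []" using offspring_nonempty[of "m w" ch "L w"] mw by (simp add: L_snoc)
    have dist: "distinct (L (w @ [a]))"
      using distinct_offspring[of "L w" ch] IH(2) ch(1)[OF hd] by (simp add: L_snoc)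
    have tl: "set (tl (L w)) \<subseteq> set (L w)" using IH(1) by (simp add: list.set_sel(2) subsetI)
    have sib: "\<exists>u\<in>V. set (L (w @ [a])) \<subseteq> kids u"
      using step
    proof
      assume sub: "set (L (w @ [a])) \<subseteq> set (tl (L w))"
      then have "L w \<noteq> [r]" using ne by auto
      then show ?thesis using IH(4) sub tl by blast
    qed (use hd in blast)
    then have "set (L (w @ [a])) \<subseteq> V" by (auto simp: kids_def)
    then show ?case using ne dist sib by blast
  qed
  define g where "g w = hd (L w)" for w
  have g_in: "g w \<in> set (L w)" and gV: "g w \<in> V" if "w \<in> W" for w
    using inv[OF that] by (auto simp: g_def)
  have mw: "2 \<le> m w" "m w \<le> length (ch (hd (L w)))" if "w \<in> W" for w
    using m[OF that] ch(3)[OF gV[OF that]] by (auto simp: g_def)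
  have chg: "set (ch (hd (L w))) = kids (g w)" "distinct (ch (hd (L w)))" if "w \<in> W" for w
    using ch(1,2)[OF gV[OF that]] by (auto simp: g_def)
  have L_step: "set (L (w @ [a])) \<subseteq> set (tl (L w)) \<or> set (L (w @ [a])) \<subseteq> kids (g w)"
    if "w @ [a] \<in> W" for w a
    using set_offspring[of "m w" ch "L w" "rk w a"] mw rk_less[OF that] that W(2)
    by (simp add: L_snoc chg)

  define dep where "dep x = (LEAST j. (p ^^ j) x = r)" for x
  have dep: "(p ^^ dep x) x = r" if "x \<in> V" for x
    using reach[OF that] unfolding dep_def by (rule LeastI_ex)
  have dep_le: "dep x \<le> j" if "(p ^^ j) x = r" for x j
    unfolding dep_def by (rule Least_le) (rule that)
  have dep_Suc: "dep x = Suc (dep (p x))" if xV: "x \<in> V" "x \<noteq> r" for x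
  proof (rule antisym)
    show "dep x \<le> Suc (dep (p x))"
      using dep[OF pV[OF xV(1)]] by (intro dep_le) (simp add: funpow_swap1)
    obtain d where d: "dep x = Suc d" using dep[OF xV(1)] xV(2) by (cases "dep x") auto
    then have "(p ^^ d) (p x) = r" using dep[OF xV(1)] by (simp add: funpow_swap1)
    then show "Suc (dep (p x)) \<le> dep x" using d dep_le by simp
  qed
  have dep_kids: "dep x = Suc (dep v)" if "x \<in> kids v" for x v
    using that dep_Suc by (auto simp: kids_def)
  \<comment> \<open>The depth equation counts the steps exactly: as \<open>p\<close> fixes
    \<open>r\<close>, iterates of \<open>p\<close> alone could idle at the root, and ancestors at a
    given depth would not be tied to one exponent.\<close>
  define desc where "desc y x \<longleftrightarrow> (\<exists>i. (p ^^ i) y = x \<and> dep y = dep x + i)" for y x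
  have desc_refl: "desc y y" for y unfolding desc_def by (rule exI[of _ 0]) simp
  have desc_dep: "dep x \<le> dep y" if "desc y x" for x y using that by (auto simp: desc_def)
  have desc_unique: "x = x'" if "desc y x" "desc y x'" "dep x = dep x'" for x x' y
    using that unfolding desc_def by (metis add_left_cancel)
  have desc_p: "desc y v" if yx: "desc y x" "x \<in> kids v" for x y v
  proof -
    obtain i where i: "(p ^^ i) y = x" "dep y = dep x + i" using yx(1) unfolding desc_def by blast
    then show ?thesis using dep_kids[OF yx(2)] yx(2) unfolding desc_def
      by (intro exI[of _ "Suc i"]) (auto simp: kids_def)
  qed
  have dep_L: "dep x = dep (g w)" if wx: "w \<in> W" "x \<in> set (L w)" for w x
  proof -
    have "L w = [r] \<or> (\<exists>u\<in>V. set (L w) \<subseteq> kids u)" using inv[OF wx(1)] by blast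
    then show ?thesis
    proof
      assume "L w = [r]"
      then show ?thesis using wx(2) by (simp add: g_def)
    next
      assume "\<exists>u\<in>V. set (L w) \<subseteq> kids u"
      then obtain u where "x \<in> kids u" "g w \<in> kids u" using wx(2) g_in[OF wx(1)] by blast
      then show ?thesis using dep_kids by simp
    qed
  qed

  have closed: "v \<in> W" if "v @ u \<in> W" for u v
    using that by (induction u rule: rev_induct) (auto simp: W(2) simp flip: append_assoc)
  \<comment> \<open>Extending a word replaces its list by later siblings or by children of the head,
    so every vertex below \<open>w\<close> keeps an ancestor in \<open>L w\<close>.\<close>
  have desc_L: "\<exists>x\<in>set (L w). desc (g (w @ u)) x" if "w @ u \<in> W" for w u
    using that
  proof (induction u arbitrary: w)
    case Nil
    then show ?case using g_in desc_refl by auto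
  next
    case (Cons a u)
    have wa: "w @ [a] \<in> W" "w \<in> W"
      using closed[of "w @ [a]" u] closed Cons.prems by auto
    obtain x where x: "x \<in> set (L (w @ [a]))" "desc (g (w @ a # u)) x"
      using Cons.IH[of "w @ [a]"] Cons.prems by auto
    from L_step[OF wa(1)] show ?case
    proof
      assume "set (L (w @ [a])) \<subseteq> set (tl (L w))"
      then have "x \<in> set (L w)" using x(1) inv[OF wa(2)] by (meson list.set_sel(2) subset_iff)
      then show ?thesis using x(2) by blast
    next
      assume "set (L (w @ [a])) \<subseteq> kids (g w)"
      then show ?thesis using x desc_p g_in[OF wa(2)] by blast
    qed
  qed
  \<comment> \<open>Equality would put an ancestor of \<open>g w\<close> into
    \<open>L (w @ [a])\<close>. A later sibling at the same depth would coincide with the head of a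
    distinct list; a child of \<open>g w\<close> lies too deep.\<close>
  have extend_ne: "g (w @ a # u) \<noteq> g w" if wau: "w @ a # u \<in> W" for w a u
  proof
    assume eq: "g (w @ a # u) = g w"
    have wa: "w @ [a] \<in> W" "w \<in> W" using closed[of "w @ [a]" u] closed wau by auto
    obtain x where x: "x \<in> set (L (w @ [a]))" "desc (g w) x"
      using desc_L[of "w @ [a]" u] wau eq by auto
    from L_step[OF wa(1)] show False
    proof
      assume "set (L (w @ [a])) \<subseteq> set (tl (L w))"
      then have xt: "x \<in> set (tl (L w))" using x(1) by blast
      then have "x \<in> set (L w)" using inv[OF wa(2)] by (meson list.set_sel(2))
      then have "x = g w" using desc_unique[OF x(2) desc_refl] dep_L[OF wa(2)] by simp
      then show False using xt inv[OF wa(2)] by (cases "L w") (auto simp: g_def)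
    next
      assume "set (L (w @ [a])) \<subseteq> kids (g w)"
      then show False using x desc_dep dep_kids by fastforce
    qed
  qed
  \<comment> \<open>A common vertex has ancestors in both lists. Either these are distinct children
    of \<open>g w\<close>, or a later sibling competes with \<open>g w\<close> itself; both
    contradict uniqueness of the ancestor at a given depth.\<close>
  have branch_ne_aux: "g (w @ a # u) \<noteq> g (w @ b # v)"
    if uv: "w @ a # u \<in> W" "w @ b # v \<in> W" "rk w a < rk w b" for w a b u v
  proof
    assume eq: "g (w @ a # u) = g (w @ b # v)"
    have wa: "w @ [a] \<in> W" "w @ [b] \<in> W" "w \<in> W"
      using closed[of "w @ [a]" u] closed[of "w @ [b]" v] closed uv by auto
    obtain x where x: "x \<in> set (L (w @ [a]))" "desc (g (w @ a # u)) x"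
      using desc_L[of "w @ [a]" u] uv by auto
    obtain y where y: "y \<in> set (L (w @ [b]))" "desc (g (w @ a # u)) y"
      using desc_L[of "w @ [b]" v] uv eq by auto
    have *: "set (L (w @ [b])) \<subseteq> kids (g w)"
      "set (L (w @ [a])) \<subseteq> set (tl (L w)) \<or>
       set (L (w @ [a])) \<subseteq> kids (g w) \<and> set (L (w @ [a])) \<inter> set (L (w @ [b])) = {}"
      using offspring_disjoint[of "m w" ch "L w" "rk w a" "rk w b"] mw[OF wa(3)] chg(2)[OF wa(3)] uv(3)
        rk_less[OF wa(2)]
      by (simp_all add: L_snoc chg(1)[OF wa(3)])
    have yk: "y \<in> kids (g w)" using *(1) y(1) by blast
    from *(2) show False
    proof
      assume "set (L (w @ [a])) \<subseteq> set (tl (L w))"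
      then have xt: "x \<in> set (tl (L w))" using x(1) by blast
      then have "x \<in> set (L w)" using inv[OF wa(3)] by (meson list.set_sel(2))
      moreover have "desc (g (w @ a # u)) (g w)" using desc_p y(2) yk by blast
      ultimately have "x = g w" using desc_unique x(2) dep_L[OF wa(3)] by blast
      then show False using xt inv[OF wa(3)] by (cases "L w") (auto simp: g_def)
    next
      assume "set (L (w @ [a])) \<subseteq> kids (g w) \<and> set (L (w @ [a])) \<inter> set (L (w @ [b])) = {}"
      then have "x \<in> kids (g w)" "x \<noteq> y" using x(1) y(1) by blast+
      then show False using desc_unique[OF x(2) y(2)] yk dep_kids by simp
    qed
  qed
  have branch_ne: "g (w @ a # u) \<noteq> g (w @ b # v)"
    if uv: "w @ a # u \<in> W" "w @ b # v \<in> W" "a \<noteq> b" for w a b u v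
  proof -
    have wa: "w @ [a] \<in> W" "w @ [b] \<in> W"
      using closed[of "w @ [a]" u] closed[of "w @ [b]" v] uv by auto
    then have "w \<in> W" "a \<in> A w" "b \<in> A w" using W(2) by auto
    then have "rk w a \<noteq> rk w b" using rk[of w] uv(3) by (auto simp: bij_betw_def inj_on_def)
    then show ?thesis using branch_ne_aux uv by (metis nat_neq_iff)
  qed
  have inj: "inj_on g W"
  proof (rule inj_onI, rule ccontr)
    fix w w' assume ww: "w \<in> W" "w' \<in> W" "g w = g w'" "w \<noteq> w'"
    have no_prefix: False if "strict_prefix v v'" "v' \<in> W" "g v = g v'" for v v'
      using that extend_ne by (metis strict_prefixE')
    consider "strict_prefix w w'" | "strict_prefix w' w" | "w \<parallel> w'"
      using ww(4) using prefix_cases[of w w'] by (metis strict_prefixI)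
    then show False
    proof cases
      case 3
      then show ?thesis using parallel_decomp[OF 3] branch_ne ww by metis
    qed (use ww no_prefix in metis)+
  qed
  have L_range: "y \<in> g ` W" if "w \<in> W" "y \<in> set (L w)" for y w
    using that
  \<comment> \<open>The letter of rank 0 passes on the tail, so each member of the list eventually
    becomes a head.\<close>
  proof (induction "length (L w)" arbitrary: w rule: less_induct)
    case less
    show ?case
    proof (cases "y = g w")
      case False
      then have tl: "y \<in> set (tl (L w))"
        using less.prems inv[OF less.prems(1)] by (cases "L w") (auto simp: g_def)
      obtain a where a: "a \<in> A w" "rk w a = 0"
        using rk[OF less.prems(1)] m[OF less.prems(1)]
        by (metis bij_betwE bij_betw_inv_into bij_betw_inv_into_right lessThan_iff less_le_trans zero_less_numeral)
      have "L (w @ [a]) = tl (L w)" using a(2) tl by (auto simp: L_snoc offspring_def)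
      moreover have "length (tl (L w)) < length (L w)" using inv[OF less.prems(1)] by simp
      ultimately show ?thesis using less.hyps[of "w @ [a]"] tl a(1) less.prems(1) W(2) by auto
    qed (use less in blast)
  qed
  have surj: "y \<in> g ` W" if "y \<in> V" for y
    using that
  proof (induction "dep y" arbitrary: y rule: less_induct)
    case less
    show ?case
    proof (cases "y = r")
      case True
      then show ?thesis using W(1) by (intro image_eqI[of _ _ "[]"]) (auto simp: g_def L_Nil)
    next
      case False
      then obtain w where w: "w \<in> W" "p y = g w"
        using less.hyps[of "p y"] dep_Suc[OF less.prems False] pV[OF less.prems] by auto
      then have "y \<in> set (ch (hd (L w)))" using less.prems False chg by (auto simp: kids_def)
      then obtain j where j: "j < m w" "y \<in> set (offspring ch (m w) (L w) j)"
        using offspring_cover[of y ch "L w" "m w"] mw[OF w(1)] by blast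
      obtain a where "a \<in> A w" "rk w a = j"
        using rk[OF w(1)] j(1)
        by (metis bij_betwE bij_betw_inv_into bij_betw_inv_into_right lessThan_iff)
      then show ?thesis using L_range[of "w @ [a]" y] j(2) w(1) W(2) by (simp add: L_snoc)
    qed
  qed
  have "bij_betw g W V" using inj surj gV by (auto simp: bij_betw_def)
  moreover have "p (g (w @ [a])) = g w \<or> p (g (w @ [a])) = p (g w)" if wa: "w @ [a] \<in> W" for w a
  proof -
    have w: "w \<in> W" using wa W(2) by blast
    have gi: "g (w @ [a]) \<in> set (L (w @ [a]))" using g_in[OF wa] .
    from L_step[OF wa] show ?thesis
    proof
      assume "set (L (w @ [a])) \<subseteq> set (tl (L w))"
      then have t: "g (w @ [a]) \<in> set (tl (L w))" using gi by blast
      then have "L w \<noteq> [r]" by auto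
      then obtain u where "set (L w) \<subseteq> kids u" using inv[OF w] by blast
      moreover have "g (w @ [a]) \<in> set (L w)" using t inv[OF w] by (meson list.set_sel(2))
      ultimately show ?thesis using g_in[OF w] by (auto simp: kids_def)
    next
      assume "set (L (w @ [a])) \<subseteq> kids (g w)"
      then show ?thesis using gi by (auto simp: kids_def)
    qed
  qed
  ultimately show thesis using that by blast
qed

section \<open>Non-amenable groups\<close>

lemma finite_set_mult: "\<lbrakk>finite A; finite B\<rbrakk> \<Longrightarrow> finite (A <#>\<^bsub>G\<^esub> B)"
  by (simp add: set_mult_def)

lemma (in group) inv_inv_mult: "\<lbrakk>x \<in> carrier G; y \<in> carrier G\<rbrakk> \<Longrightarrow> inv (inv x \<otimes> y) = inv y \<otimes> x"
  by (simp add: inv_mult_group)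

lemma (in group) inv_mult_chain:
  assumes "x \<in> carrier G" "y \<in> carrier G" "z \<in> carrier G"
  shows "(inv x \<otimes> y) \<otimes> (inv y \<otimes> z) = inv x \<otimes> z"
proof -
  have "y \<otimes> (inv y \<otimes> z) = z" using assms by (simp flip: m_assoc)
  then show ?thesis using assms by (simp add: m_assoc)
qed

text \<open>Expansion by the factor \<open>n\<close> is Hall's condition for \<open>n\<close> copies
  of every element. The matching \<open>h\<close> sends the copies of \<open>x\<close> into the
  translate of \<open>T\<close> by \<open>x\<close>, and \<open>f\<close> inverts
  \<open>h\<close>.\<close>

lemma (in group) nonamenable_imp_many_to_one:
  assumes "\<not> amenable G"
  obtains f where "\<And>x. x \<in> carrier G \<Longrightarrow> f x \<in> carrier G"
    "finite ((\<lambda>x. inv x \<otimes> f x) ` carrier G)"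
    "\<And>v. v \<in> carrier G \<Longrightarrow> \<exists>B. B \<subseteq> {x \<in> carrier G. f x = v} \<and> finite B \<and> card B = n"
proof -
  obtain T where T: "finite T" "T \<subseteq> carrier G"
    and exp: "\<And>A. \<lbrakk>finite A; A \<subseteq> carrier G\<rbrakk> \<Longrightarrow> n * card A \<le> card (A <#> T)"
    using nonamenable_large_expansion[OF assms] by blast
  define R where "R = {((x, i :: nat), y). x \<in> carrier G \<and> i < n \<and> y \<in> (\<lambda>t. x \<otimes> t) ` T}"
  let ?I = "carrier G \<times> {..<n}"
  have Rz: "R `` {(x, i)} \<subseteq> (\<lambda>t. x \<otimes> t) ` T" for x i by (auto simp: R_def)
  have finR: "finite (R `` {z})" for z
    using finite_subset[OF Rz finite_imageI[OF T(1)]] by (cases z) simp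
  have hallR: "card A \<le> card (R `` A)" if A: "finite A" "A \<subseteq> ?I" for A
  proof -
    have "A \<subseteq> fst ` A \<times> {..<n}" using A(2) by force
    then have "card A \<le> card (fst ` A \<times> {..<n})" using A(1) by (intro card_mono) auto
    also have "\<dots> = n * card (fst ` A)" by (simp add: card_cartesian_product)
    also have "\<dots> \<le> card (fst ` A <#> T)" using A by (intro exp) auto
    also have "fst ` A <#> T = R `` A"
    proof
      show "fst ` A <#> T \<subseteq> R `` A"
      proof
        fix y assume "y \<in> fst ` A <#> T"
        then obtain x i t where "(x, i) \<in> A" "t \<in> T" "y = x \<otimes> t" by (auto simp: set_mult_def)
        then have "((x, i), y) \<in> R" using A(2) by (auto simp: R_def)
        then show "y \<in> R `` A" using \<open>(x, i) \<in> A\<close> by blast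
      qed
      show "R `` A \<subseteq> fst ` A <#> T"
      proof
        fix y assume "y \<in> R `` A"
        then obtain x i t where "(x, i) \<in> A" "t \<in> T" "y = x \<otimes> t" by (auto simp: R_def)
        moreover from this have "x \<in> fst ` A" by (simp add: rev_image_eqI)
        ultimately show "y \<in> fst ` A <#> T" unfolding set_mult_def by blast
      qed
    qed
    finally show ?thesis .
  qed
  note hall = infinite_Hall[of R ?I, OF finR hallR]
  have "\<exists>h. inj_on h ?I \<and> (\<forall>z\<in>?I. (z, h z) \<in> R)"
    by (rule hall, assumption, assumption) (intro exI conjI ballI)
  then obtain h where h: "inj_on h ?I" "\<And>z. z \<in> ?I \<Longrightarrow> (z, h z) \<in> R"
    by blast
  have hT: "\<exists>t\<in>T. h (x, i) = x \<otimes> t" if "x \<in> carrier G" "i < n" for x i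
    using h(2)[of "(x, i)"] that by (auto simp: R_def)
  \<comment> \<open>Unmatched points stay fixed: this adds only the displacement
    \<open>\<one>\<close> and can only enlarge a fibre.\<close>
  define f where "f y = (if y \<in> h ` ?I then fst (inv_into ?I h y) else y)" for y
  have f_h: "f (h (x, i)) = x" if "x \<in> carrier G" "i < n" for x i
    using that h(1) by (simp add: f_def)
  have cases: "f y = y \<or> (\<exists>t\<in>T. y = f y \<otimes> t \<and> f y \<in> carrier G)" if "y \<in> carrier G" for y
  proof (cases "y \<in> h ` ?I")
    case True
    then obtain x i where "x \<in> carrier G" "i < n" "y = h (x, i)" by auto
    then show ?thesis using f_h hT by metis
  qed (simp add: f_def)
  have "f x \<in> carrier G" if "x \<in> carrier G" for x using cases[OF that] that by auto
  moreover have "(\<lambda>x. inv x \<otimes> f x) ` carrier G \<subseteq> insert \<one> (m_inv G ` T)"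
  proof (rule image_subsetI)
    fix x assume x: "x \<in> carrier G"
    from cases[OF x] show "inv x \<otimes> f x \<in> insert \<one> (m_inv G ` T)"
    proof
      assume "\<exists>t\<in>T. x = f x \<otimes> t \<and> f x \<in> carrier G"
      then obtain t where t: "t \<in> T" "x = f x \<otimes> t" "f x \<in> carrier G" by blast
      have tc: "t \<in> carrier G" using t(1) T(2) by blast
      have "inv x = inv t \<otimes> inv (f x)" using inv_mult_group[OF t(3) tc] t(2) by simp
      then have "inv x \<otimes> f x = inv t" using t(3) tc by (simp add: m_assoc)
      then show ?thesis using t(1) by blast
    qed (use x in simp)
  qed
  then have "finite ((\<lambda>x. inv x \<otimes> f x) ` carrier G)"
    by (rule finite_subset) (use T(1) in simp)
  moreover have "\<exists>B. B \<subseteq> {x \<in> carrier G. f x = v} \<and> finite B \<and> card B = n" if v: "v \<in> carrier G" for v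
  proof (intro exI conjI)
    let ?B = "(\<lambda>i. h (v, i)) ` {..<n}"
    show "?B \<subseteq> {x \<in> carrier G. f x = v}" using f_h v hT T(2) by fastforce
    have "inj_on (\<lambda>i. h (v, i)) {..<n}"
      using h(1) v by (intro inj_onI) (auto dest: inj_onD)
    then show "card ?B = n" by (simp add: card_image)
  qed simp
  ultimately show thesis using that by blast
qed

text \<open>\<open>q\<close> drops the last generator of a shortest word for \<open>x\<close>, so
  its displacements are inverses of generators.\<close>

lemma (in group) shortening_map:
  assumes S: "finite S" "S \<subseteq> carrier G" "generate G S = carrier G"
  obtains q len where "\<And>x. \<lbrakk>x \<in> carrier G; x \<noteq> \<one>\<rbrakk> \<Longrightarrow> q x \<in> carrier G \<and> len (q x) < (len x :: nat)"
    "len \<one> = 0" "finite ((\<lambda>x. inv x \<otimes> q x) ` (carrier G - {\<one>}))"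
proof -
  let ?T = "S \<union> m_inv G ` S"
  have T: "finite ?T" "?T \<subseteq> carrier G" using S by auto
  define len where "len x = (LEAST n. x \<in> prod_set G ?T n)" for x
  have len: "x \<in> prod_set G ?T (len x)" if "x \<in> carrier G" for x
    unfolding len_def by (rule LeastI_ex) (use generate_prod_set[OF S(2)] S(3) that in auto)
  have len_le: "len x \<le> n" if "x \<in> prod_set G ?T n" for x n
    unfolding len_def by (rule Least_le) (rule that)
  have "\<exists>y t. y \<in> carrier G \<and> len y < len x \<and> t \<in> ?T \<and> x = y \<otimes> t"
    if x: "x \<in> carrier G" "x \<noteq> \<one>" for x
  proof -
    have "len x \<noteq> 0"
    proof
      assume "len x = 0"
      then have "x \<in> prod_set G ?T 0" using len[OF x(1)] by simp
      then show False using x(2) by (simp add: prod_set_def)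
    qed
    then obtain n where n: "len x = Suc n" by (cases "len x") auto
    then have "x \<in> prod_set G ?T (Suc n)" using len[OF x(1)] by simp
    then obtain y t where yt: "y \<in> prod_set G ?T n" "t \<in> ?T" "x = y \<otimes> t"
      using prod_set_SucE[OF T(2)] by metis
    moreover have "y \<in> carrier G" using yt(1) prod_set_carrier[OF T(2)] by blast
    ultimately show ?thesis using len_le[OF yt(1)] n by (metis less_Suc_eq_le)
  qed
  then obtain q t where q: "\<And>x. \<lbrakk>x \<in> carrier G; x \<noteq> \<one>\<rbrakk> \<Longrightarrow>
      q x \<in> carrier G \<and> len (q x) < len x \<and> t x \<in> ?T \<and> x = q x \<otimes> t x"
    by metis
  have "(\<lambda>x. inv x \<otimes> q x) ` (carrier G - {\<one>}) \<subseteq> m_inv G ` ?T"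
  proof (rule image_subsetI)
    fix x assume "x \<in> carrier G - {\<one>}"
    then have qx: "q x \<in> carrier G" "t x \<in> ?T" "x = q x \<otimes> t x" using q by auto
    then have tc: "t x \<in> carrier G" using T(2) by blast
    have "inv x = inv (t x) \<otimes> inv (q x)" using inv_mult_group[OF qx(1) tc] qx(3) by simp
    then have "inv x \<otimes> q x = inv (t x)" using qx(1) tc by (simp add: m_assoc)
    then show "inv x \<otimes> q x \<in> m_inv G ` ?T" using qx(2) by blast
  qed
  then have "finite ((\<lambda>x. inv x \<otimes> q x) ` (carrier G - {\<one>}))"
    by (rule finite_subset) (use T(1) in simp)
  moreover have "len \<one> = 0" using len_le[of \<one> 0] by (simp add: prod_set_def)
  ultimately show thesis using that[of q len] q by blast
qed

lemma (in group) nonamenable_rooted_tree: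
  assumes S: "finite S" "S \<subseteq> carrier G" "generate G S = carrier G" and na: "\<not> amenable G"
  obtains p where "\<And>x. x \<in> carrier G \<Longrightarrow> p x \<in> carrier G" "p \<one> = \<one>"
    "\<And>x. x \<in> carrier G \<Longrightarrow> \<exists>j. (p ^^ j) x = \<one>"
    "finite ((\<lambda>x. inv x \<otimes> p x) ` carrier G)"
    "\<And>v. v \<in> carrier G \<Longrightarrow> finite {x \<in> carrier G. x \<noteq> \<one> \<and> p x = v}"
    "\<And>v. v \<in> carrier G \<Longrightarrow> N \<le> card {x \<in> carrier G. x \<noteq> \<one> \<and> p x = v}"
proof -
  obtain f where f: "\<And>x. x \<in> carrier G \<Longrightarrow> f x \<in> carrier G"
    "finite ((\<lambda>x. inv x \<otimes> f x) ` carrier G)"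
    "\<And>v. v \<in> carrier G \<Longrightarrow> \<exists>B. B \<subseteq> {x \<in> carrier G. f x = v} \<and> finite B \<and> card B = N + 2"
    \<comment> \<open>Two spare preimages pay for those lost in the reorientation.\<close>
    using nonamenable_imp_many_to_one[OF na, of "N + 2"] by blast
  obtain q and len :: "'a \<Rightarrow> nat" where
    q: "\<And>x. \<lbrakk>x \<in> carrier G; x \<noteq> \<one>\<rbrakk> \<Longrightarrow> q x \<in> carrier G \<and> len (q x) < len x"
    "len \<one> = 0" "finite ((\<lambda>x. inv x \<otimes> q x) ` (carrier G - {\<one>}))"
    by (rule shortening_map[OF S]) (rule that)
  have "\<exists>p. (\<forall>x\<in>carrier G. x \<noteq> \<one> \<longrightarrow> p x \<in> carrier G \<and> (p x = f x \<or> p x = q x \<or> f (p x) = x)) \<and>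
    (\<forall>x\<in>carrier G. \<exists>j. (p ^^ j) x = \<one>) \<and> p \<one> = \<one> \<and>
    (\<forall>v\<in>carrier G. \<exists>E. finite E \<and> card E \<le> 2 \<and>
      (\<forall>x\<in>carrier G - E. f x = v \<longrightarrow> x \<noteq> \<one> \<and> p x = v))"
    using f(1) q(1,2) by (intro rooted_reorientation[where len = len]) auto
  then obtain p where p: "\<forall>x\<in>carrier G. x \<noteq> \<one> \<longrightarrow> p x \<in> carrier G \<and> (p x = f x \<or> p x = q x \<or> f (p x) = x)"
    "\<forall>x\<in>carrier G. \<exists>j. (p ^^ j) x = \<one>" "p \<one> = \<one>"
    and E: "\<forall>v\<in>carrier G. \<exists>E. finite E \<and> card E \<le> 2 \<and>
      (\<forall>x\<in>carrier G - E. f x = v \<longrightarrow> x \<noteq> \<one> \<and> p x = v)"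
    by (elim exE conjE)
  have pG: "p x \<in> carrier G" if "x \<in> carrier G" for x
    using p(1) that p(3) by (cases "x = \<one>") auto
  let ?Df = "(\<lambda>x. inv x \<otimes> f x) ` carrier G" and ?Dq = "(\<lambda>x. inv x \<otimes> q x) ` (carrier G - {\<one>})"
  \<comment> \<open>The sets match the options for \<open>p x\<close>: an edge of \<open>f\<close>,
    a shortening step, a reversed edge of \<open>f\<close>, and the fixed root.\<close>
  have "(\<lambda>x. inv x \<otimes> p x) ` carrier G \<subseteq> insert \<one> (?Df \<union> ?Dq \<union> m_inv G ` ?Df)"
  proof (rule image_subsetI)
    fix x assume x: "x \<in> carrier G"
    show "inv x \<otimes> p x \<in> insert \<one> (?Df \<union> ?Dq \<union> m_inv G ` ?Df)"
    proof (cases "x = \<one>")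
      case False
      then consider "p x = f x" | "p x = q x" | "f (p x) = x" using p(1) x by blast
      then show ?thesis
      proof cases
        case 3
        then have "inv x \<otimes> p x = inv (inv (p x) \<otimes> f (p x))"
          using x pG by (simp add: inv_inv_mult)
        then show ?thesis using pG[OF x] by blast
      qed (use x False in auto)
    qed (simp add: p(3))
  qed
  then have fin: "finite ((\<lambda>x. inv x \<otimes> p x) ` carrier G)"
    by (rule finite_subset) (use f(2) q(3) in simp)
  have finkids: "finite {x \<in> carrier G. x \<noteq> \<one> \<and> p x = v}" if v: "v \<in> carrier G" for v
  proof (rule finite_subset)
    show "{x \<in> carrier G. x \<noteq> \<one> \<and> p x = v} \<subseteq> (\<lambda>d. v \<otimes> inv d) ` (\<lambda>x. inv x \<otimes> p x) ` carrier G"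
    proof
      fix x assume "x \<in> {x \<in> carrier G. x \<noteq> \<one> \<and> p x = v}"
      then have x: "x \<in> carrier G" "p x = v" by auto
      \<comment> \<open>A child is determined by its parent and its displacement, of which there are
        finitely many.\<close>
      then have "x = v \<otimes> inv (inv x \<otimes> p x)" using v by (simp add: inv_mult_group flip: m_assoc)
      then show "x \<in> (\<lambda>d. v \<otimes> inv d) ` (\<lambda>x. inv x \<otimes> p x) ` carrier G" using x(1) by blast
    qed
  qed (use fin in simp)
  have "N \<le> card {x \<in> carrier G. x \<noteq> \<one> \<and> p x = v}" if v: "v \<in> carrier G" for v
  proof -
    obtain B where B: "B \<subseteq> {x \<in> carrier G. f x = v}" "finite B" "card B = N + 2" using f(3)[OF v] by blast
    obtain E where E': "finite E" "card E \<le> 2"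
      "\<forall>x\<in>carrier G - E. f x = v \<longrightarrow> x \<noteq> \<one> \<and> p x = v" using E v by blast
    have "N \<le> card B - card E" using B(3) E'(2) by simp
    also have "\<dots> \<le> card (B - E)" by (rule diff_card_le_card_Diff[OF E'(1)])
    also have "\<dots> \<le> card {x \<in> carrier G. x \<noteq> \<one> \<and> p x = v}"
      using B(1) E'(3) by (intro card_mono finkids[OF v]) auto
    finally show ?thesis .
  qed
  then show thesis using that[of p] pG p(2,3) fin finkids by blast
qed

lemma (in group) nonamenable_imp_transitive_action:
  assumes S: "finite S" "S \<subseteq> carrier G" "generate G S = carrier G" and na: "\<not> amenable G"
    and k: "k \<ge> 2"
  obtains act where "translation_like G S (free_group k) act" "transitive_action G (free_group k) act"
proof -
  let ?F = "free_group k"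
  interpret F: group ?F by (rule group_free_group)
  obtain p where p: "\<And>x. x \<in> carrier G \<Longrightarrow> p x \<in> carrier G" "p \<one> = \<one>"
    "\<And>x. x \<in> carrier G \<Longrightarrow> \<exists>j. (p ^^ j) x = \<one>"
    "finite ((\<lambda>x. inv x \<otimes> p x) ` carrier G)"
    "\<And>v. v \<in> carrier G \<Longrightarrow> finite {x \<in> carrier G. x \<noteq> \<one> \<and> p x = v}"
    "\<And>v. v \<in> carrier G \<Longrightarrow> 2 * k \<le> card {x \<in> carrier G. x \<noteq> \<one> \<and> p x = v}"
    using nonamenable_rooted_tree[OF S na, of "2 * k"] by blast
  \<comment> \<open>Letters that extend a reduced word without cancelling: \<open>2 * k\<close>
    after the empty word and \<open>2 * k - 1\<close> after any other element of the free
    group.\<close>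
  define A where "A w = {a :: nat \<times> bool. fst a < k \<and> (w = [] \<or> last w \<noteq> letter_inv a)}" for w
  have letters: "{a :: nat \<times> bool. fst a < k} = {..<k} \<times> UNIV" by auto
  have fin_letters: "finite {a :: nat \<times> bool. fst a < k}"
    and card_letters: "card {a :: nat \<times> bool. fst a < k} = 2 * k"
    by (simp_all add: letters card_cartesian_product)
  have finA: "finite (A w)" and cardA: "2 \<le> card (A w)" "card (A w) \<le> 2 * k" for w
  proof -
    have sub: "A w \<subseteq> {a. fst a < k}" by (auto simp: A_def)
    show "finite (A w)" using fin_letters sub by (rule finite_subset[rotated])
    show "card (A w) \<le> 2 * k" using card_mono[OF fin_letters sub] card_letters by simp
    \<comment> \<open>For empty \<open>w\<close> the value \<open>last w\<close> is unspecified, but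
      discarding one letter still gives a valid lower bound.\<close>
    have "{a :: nat \<times> bool. fst a < k} - {letter_inv (last w)} \<subseteq> A w" by (auto simp: A_def)
    then have "card ({a :: nat \<times> bool. fst a < k} - {letter_inv (last w)}) \<le> card (A w)"
      using \<open>finite (A w)\<close> by (rule card_mono[rotated])
    moreover have "2 * k - 1 \<le> card ({a :: nat \<times> bool. fst a < k} - {letter_inv (last w)})"
      using diff_card_le_card_Diff[of "{letter_inv (last w)}" "{a :: nat \<times> bool. fst a < k}"] card_letters
      by simp
    ultimately show "2 \<le> card (A w)" using k by simp
  qed
  obtain rk where rk: "\<And>w. bij_betw (rk w) (A w) {..<card (A w)}"
    using ex_bij_betw_finite_nat[OF finA] by (metis atLeast0LessThan)
  have F_snoc: "w @ [a] \<in> carrier ?F \<longleftrightarrow> w \<in> carrier ?F \<and> a \<in> A w" for w a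
    by (auto simp: carrier_free_group reduced_snoc A_def)
  obtain g where g: "bij_betw g (carrier ?F) (carrier G)"
    and edge: "\<And>w a. w @ [a] \<in> carrier ?F \<Longrightarrow> p (g (w @ [a])) = g w \<or> p (g (w @ [a])) = p (g w)"
  proof (rule tree_regularization[of \<one> "carrier G" p "2 * k" "carrier ?F" A rk "\<lambda>w. card (A w)"])
    show "[] \<in> carrier ?F" using F.one_closed by (simp add: one_free_group)
  qed (use p rk cardA F_snoc in auto)
  have gG: "g w \<in> carrier G" if "w \<in> carrier ?F" for w using g that by (auto simp: bij_betw_def)
  define Dp where "Dp = (\<lambda>x. inv x \<otimes> p x) ` carrier G"
  have Dp: "finite Dp" "Dp \<subseteq> carrier G" using p(1,4) by (auto simp: Dp_def)
  \<comment> \<open>The first part covers edges from a vertex to its \<open>p\<close>-child, the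
    second covers edges between siblings through their common parent.\<close>
  define D where "D = m_inv G ` Dp \<union> (Dp <#> m_inv G ` Dp)"
  have D: "finite D" "D \<subseteq> carrier G" using Dp by (auto simp: D_def set_mult_def)
  have edgeD: "inv (g w) \<otimes> g (w @ [a]) \<in> D" if wa: "w @ [a] \<in> carrier ?F" for w a
  proof -
    let ?x = "g w" and ?y = "g (w @ [a])"
    have x: "?x \<in> carrier G" and y: "?y \<in> carrier G" using wa F_snoc gG by auto
    from edge[OF wa] show ?thesis
    proof
      assume "p ?y = ?x"
      then have "inv ?x \<otimes> ?y = inv (inv ?y \<otimes> p ?y)" using x y by (simp add: inv_inv_mult)
      then show ?thesis using y by (auto simp: D_def Dp_def)
    next
      assume eq: "p ?y = p ?x"
      have "inv ?x \<otimes> ?y = (inv ?x \<otimes> p ?x) \<otimes> inv (inv ?y \<otimes> p ?y)"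
        using x y p(1)[OF x] unfolding eq by (simp add: inv_inv_mult inv_mult_chain)
      then show ?thesis using x y unfolding D_def Dp_def set_mult_def by blast
    qed
  qed
  \<comment> \<open>A letter may cancel, which traverses a tree edge backwards; hence the inverses
    of \<open>D\<close>.\<close>
  have letterD: "inv (g w) \<otimes> g (w \<otimes>\<^bsub>?F\<^esub> [a]) \<in> D \<union> m_inv G ` D"
    if w: "w \<in> carrier ?F" and a: "fst a < k" for w a
  proof (cases "w \<noteq> [] \<and> last w = letter_inv a")
    case True
    define v where "v = butlast w"
    have wv: "w = v @ [letter_inv a]" using True by (metis append_butlast_last_id v_def)
    have v: "v \<in> carrier ?F" using w wv F_snoc by metis
    have "w \<otimes>\<^bsub>?F\<^esub> [a] = v"
      using True w foldr_push_snoc[of w a] by (simp add: mult_free_group carrier_free_group v_def)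
    moreover have "inv (g w) \<otimes> g v = inv (inv (g v) \<otimes> g w)"
      using gG[OF v] gG[OF w] by (simp add: inv_inv_mult)
    moreover have "inv (g v) \<otimes> g w \<in> D" using edgeD[of v "letter_inv a"] w wv by simp
    ultimately show ?thesis by auto
  next
    case False
    then have "w \<otimes>\<^bsub>?F\<^esub> [a] = w @ [a]"
      using w foldr_push_snoc[of w a] by (auto simp: mult_free_group carrier_free_group)
    moreover have "w @ [a] \<in> carrier ?F" using False w a by (auto simp: F_snoc A_def)
    ultimately show ?thesis using edgeD by simp
  qed
  have wordD: "finite ((\<lambda>w. inv (g w) \<otimes> g (w \<otimes>\<^bsub>?F\<^esub> h)) ` carrier ?F)" if "h \<in> carrier ?F" for h
    using that
  proof (induction h)
    case Nil
    have "inv (g w) \<otimes> g (w \<otimes>\<^bsub>?F\<^esub> []) = \<one>" if "w \<in> carrier ?F" for w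
      using F.r_one[OF that] gG[OF that] by (simp add: one_free_group)
    then have "(\<lambda>w. inv (g w) \<otimes> g (w \<otimes>\<^bsub>?F\<^esub> [])) ` carrier ?F \<subseteq> {\<one>}" by auto
    then show ?case by (rule finite_subset) simp
  next
    case (Cons a h)
    have ah: "fst a < k" "h \<in> carrier ?F" "[a] \<otimes>\<^bsub>?F\<^esub> h = a # h"
      using free_group_Cons[OF Cons.prems] by auto
    let ?E = "D \<union> m_inv G ` D" and ?Q = "(\<lambda>w. inv (g w) \<otimes> g (w \<otimes>\<^bsub>?F\<^esub> h)) ` carrier ?F"
    \<comment> \<open>\<open>?Q\<close> collects the displacements of \<open>h\<close> from every
      starting word, so it also bounds the move that starts at \<open>w\<close> multiplied by
      \<open>[a]\<close>.\<close>
    have "inv (g w) \<otimes> g (w \<otimes>\<^bsub>?F\<^esub> (a # h)) \<in> ?E <#> ?Q" if w: "w \<in> carrier ?F" for w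
    proof -
      let ?v = "w \<otimes>\<^bsub>?F\<^esub> [a]"
      have v: "?v \<in> carrier ?F" using w letter_in_free_group[OF ah(1)] by simp
      have vh: "w \<otimes>\<^bsub>?F\<^esub> (a # h) = ?v \<otimes>\<^bsub>?F\<^esub> h"
        using F.m_assoc[OF w letter_in_free_group[OF ah(1)] ah(2)] ah(3) by simp
      have "(inv (g w) \<otimes> g ?v) \<otimes> (inv (g ?v) \<otimes> g (?v \<otimes>\<^bsub>?F\<^esub> h)) \<in> ?E <#> ?Q"
        using letterD[OF w ah(1)] v unfolding set_mult_def by blast
      then show ?thesis
        using gG[OF w] gG[OF v] gG[OF F.m_closed[OF v ah(2)]] by (simp only: vh inv_mult_chain)
    qed
    then have "(\<lambda>w. inv (g w) \<otimes> g (w \<otimes>\<^bsub>?F\<^esub> (a # h))) ` carrier ?F \<subseteq> ?E <#> ?Q" by blast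
    moreover have "finite (?E <#> ?Q)"
      using D(1) Cons.IH[OF ah(2)] by (intro finite_set_mult) auto
    ultimately show ?case by (rule finite_subset)
  qed
  define gi where "gi = inv_into (carrier ?F) g"
  have gi: "gi x \<in> carrier ?F" "g (gi x) = x" if "x \<in> carrier G" for x
    using g that by (auto simp: gi_def bij_betw_def inv_into_into f_inv_into_f)
  have gi_g: "gi (g w) = w" if "w \<in> carrier ?F" for w
    using g that by (simp add: gi_def bij_betw_def)
  \<comment> \<open>Right multiplication of the free group on itself is free and transitive, and
    both properties survive transport along the bijection \<open>g\<close>.\<close>
  define act where "act x h = g (gi x \<otimes>\<^bsub>?F\<^esub> h)" for x h
  have actG: "act x h \<in> carrier G" if "x \<in> carrier G" "h \<in> carrier ?F" for x h
    using that gi gG by (simp add: act_def)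
  have "right_action G ?F act"
    unfolding right_action_def
    using actG by (simp add: act_def gi gi_g F.m_assoc)
  moreover have "h = \<one>\<^bsub>?F\<^esub>" if "x \<in> carrier G" "h \<in> carrier ?F" "act x h = x" for x h
  proof -
    have "gi x \<otimes>\<^bsub>?F\<^esub> h = gi x" using gi_g[of "gi x \<otimes>\<^bsub>?F\<^esub> h"] that gi(1) by (simp add: act_def)
    then show ?thesis using that gi(1) F.l_cancel_one by simp
  qed
  moreover have "\<exists>B. \<forall>x\<in>carrier G. word_dist G S x (act x h) \<le> B" if h: "h \<in> carrier ?F" for h
  proof -
    have "(\<lambda>x. inv x \<otimes> act x h) ` carrier G \<subseteq> (\<lambda>w. inv (g w) \<otimes> g (w \<otimes>\<^bsub>?F\<^esub> h)) ` carrier ?F"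
    proof (rule image_subsetI)
      fix x assume "x \<in> carrier G"
      then show "inv x \<otimes> act x h \<in> (\<lambda>w. inv (g w) \<otimes> g (w \<otimes>\<^bsub>?F\<^esub> h)) ` carrier ?F"
        using gi by (intro image_eqI[of _ _ "gi x"]) (simp_all add: act_def)
    qed
    then have "finite ((\<lambda>x. inv x \<otimes> act x h) ` carrier G)" using wordD[OF h] by (rule finite_subset)
    then show ?thesis using word_dist_bounded_iff[OF S, of "\<lambda>x. act x h"] actG h by blast
  qed
  ultimately have "translation_like G S ?F act" by (simp add: translation_like_def)
  moreover have "transitive_action G ?F act"
    unfolding transitive_action_def
  proof (intro ballI)
    fix x y assume xy: "x \<in> carrier G" "y \<in> carrier G"
    have "act x (inv\<^bsub>?F\<^esub> (gi x) \<otimes>\<^bsub>?F\<^esub> gi y) = y"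
      using xy gi by (simp add: act_def F.inv_solve_left' flip: F.m_assoc)
    moreover have "inv\<^bsub>?F\<^esub> (gi x) \<otimes>\<^bsub>?F\<^esub> gi y \<in> carrier ?F" using xy gi(1) by simp
    ultimately show "\<exists>h\<in>carrier ?F. act x h = y" by blast
  qed
  ultimately show thesis using that by blast
qed

theorem theorem5p6:
  fixes G :: "('a, 'b) monoid_scheme" and S :: "'a set" and k :: nat
  assumes "group G" and "finite S" and "S \<subseteq> carrier G"
    and "generate G S = carrier G" and "k \<ge> 2"
  shows "(\<not> amenable G \<longleftrightarrow> (\<exists>act. translation_like G S (free_group k) act)) \<and>
         (\<not> amenable G \<longleftrightarrow> (\<exists>act. translation_like G S (free_group k) act
                                       \<and> transitive_action G (free_group k) act))"
proof -
  interpret group G by fact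
  have "\<not> amenable G" if "translation_like G S (free_group k) act" for act
    using translation_like_imp_nonamenable that assms by blast
  moreover have "\<exists>act. translation_like G S (free_group k) act \<and> transitive_action G (free_group k) act"
    if "\<not> amenable G"
    using nonamenable_imp_transitive_action[OF assms(2-4) that assms(5)] by metis
  ultimately show ?thesis by blast
qed

end
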